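(* Let $m>0$ and let $\mu$ be a probability measure on $\mathbb T=\mathbb R/2\pi\mathbb Z$ whose cumulative distribution function $F_\mu$ satisfies $F_\mu(\theta+h)-F_\mu(\theta)\ge mh$ for all $\theta\in\mathbb R$ and all $h\ge 0$. Let $0<m'\le m$. Then there exists at most one viscosity solution $F:[0,\infty)\times\mathbb R\to\mathbb R$ of $$\partial_t F(t,\theta)+\frac1\pi\left(\arctan\left(\frac{A_0[F(t,\cdot)](\theta)}{(\partial_\theta F(t,\theta))_+}\right)+\frac{\pi}{2}\right)=0\quad\text{in }(0,+\infty)\times\mathbb R$$ with initial condition $F_\mu$ which satisfies $F(t,\theta+h)-F(t,\theta)\ge m'h$ for all $t\ge 0$, $\theta\in\mathbb R$ and $h\ge 0$.
   Context: **Cumulative distribution function.** A probability measure $\mu$ on $\mathbb T$ is identified with its $2\pi$-periodic lift to $\mathbb R$. Set $F_\mu(x)=\mu([0,x])$ if $x\ge 0$ and $F_\mu(x)=-\mu((x,0))$ if $x<0$. Thus $F_\mu$ is non-decreasing, right-continuous and $F_\mu(x+2\pi)=F_\mu(x)+1$. **Envelopes.** For a locally bounded function $F$ on a subset $\Omega$ of $\mathbb R^d$ and $x\in\Omega$: $F_*(x)=\liminf_{y\to x}F(y)$ and $F^*(x)=\limsup_{y\to x}F(y)$ (lower and upper semicontinuous envelopes; $y\in\Omega$, $y=x$ allowed). **Function spaces.** $\mathcal F_{t,2\pi}$ is the set of functions $F:[0,\infty)\times\mathbb R\to\mathbb R$ for which there is $a\in\mathbb R$ with $F(t,x+2\pi)=F(t,x)+a$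 for all $t\ge0$, $x\in\mathbb R$. $C^{1,1}_{t,2\pi}$ is the set of $C^1$ functions $\phi:[0,\infty)\times\mathbb R\to\mathbb R$ such that $\partial_x\phi$ is Lipschitz and $\phi\in\mathcal F_{t,2\pi}$. **Half-Laplacian.** For a $C^1$ function $f:\mathbb R\to\mathbb R$ with $f'$ Lipschitz and $f(x+2\pi)-f(x)$ constant, $$A_0[f](\theta)=\frac1{8\pi}\int_{-\pi}^{\pi}\frac{2f(\theta)-f(\theta-\theta')-f(\theta+\theta')}{\sin^2(\theta'/2)}\,d\theta'.$$ **Viscosity solutions.** Write $y_+=\max(y,0)$. - An upper semicontinuous $F\in\mathcal F_{t,2\pi}$ is a viscosity subsolution if for every $\phi\in C^{1,1}_{t,2\pi}$ and every point $(t_0,\theta_0)\in(0,\infty)\times\mathbb R$ of strict maximum of $F-\phi$ with $\partial_\theta\phi(t_0,\theta_0)\ne0$, $$\partial_t\phi(t_0,\theta_0)+\frac1\pi\left(\arctan\left(\frac{A_0[\phi(t_0,\cdot)](\theta_0)}{(\partial_\theta\phi(t_0,\theta_0))_+}\right)+\frac\pi2\right)\le0.$$ - A lower semicontinuous $F\in\mathcal F_{t,2\pi}$ is a viscosity supersolution if the same holds with "strict maximum" replaced by "strict minimum" and $\le0$ replaced by $\ge0$. - A viscosity solution is a locally bounded function $F$ such that $F$ is a subsolution and $F_*$ is a supersolution. - $F$ has initial condition $F_0$ if $F^*(0,\cdot)\le (F_0)^*$ and $F_*(0,\cdot)\ge(F_0)_*$. Here a strict maximum (minimum) is a maximum (minimum)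 over $[0,\infty)\times\mathbb R$, attained only at the points $(t_0,\theta_0+2\pi k)$, $k\in\mathbb Z$. For functions $F$ with $F(t,\theta+h)-F(t,\theta)\ge m'h$ for all $t,h\ge 0$, $\theta\in\mathbb R$, one always has $\partial_\theta\phi(t_0,\theta_0)\ge m'>0$ at such points, so no division by zero occurs. *)

theory Defs
  imports "HOL-Probability.Probability"
begin

section \<open>Probability measures on the circle and their distribution functions\<close>

text \<open>The torus \<open>\<real> / 2\<pi>\<int>\<close> is realised as the unit circle of the complex plane, via
  \<open>\<theta> \<mapsto> cis \<theta>\<close>.\<close>

definition prob_measure_torus :: "complex measure \<Rightarrow> bool" where
  "prob_measure_torus \<mu> \<longleftrightarrow>
     prob_space \<mu> \<and> sets \<mu> = sets (restrict_space borel (sphere 0 1))"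

text \<open>The \<open>2\<pi>\<close>-periodic lift: every \<open>z\<close> on the circle is spread, with unit multiplicity,
  over all its real arguments \<open>Arg2pi z + 2\<pi>k\<close>, where \<open>0 \<le> Arg2pi z < 2\<pi>\<close>.\<close>

definition torus_lift :: "complex measure \<Rightarrow> real measure" where
  "torus_lift \<mu> =
     distr (\<mu> \<Otimes>\<^sub>M count_space (UNIV :: int set)) borel
       (\<lambda>(z, k). Arg2pi z + 2 * pi * of_int k)"

definition torus_cdf :: "complex measure \<Rightarrow> real \<Rightarrow> real" where
  "torus_cdf \<mu> x =
     (if 0 \<le> x then measure (torus_lift \<mu>) {0..x} else - measure (torus_lift \<mu>) {x<..<0})"

section \<open>Semicontinuity and envelopes\<close>

definition locally_bounded_on :: "'a::metric_space set \<Rightarrow> ('a \<Rightarrow> real) \<Rightarrow> bool" where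
  "locally_bounded_on S F \<longleftrightarrow> (\<forall>x\<in>S. \<exists>r>0. bounded (F ` (S \<inter> ball x r)))"

text \<open>In contrast to \<open>at x within S\<close>, the filter \<open>inf (nhds x) (principal S)\<close> does not
  exclude the point \<open>x\<close>. The limits are taken in the extended reals; for \<open>x \<in> S\<close> and
  \<open>F\<close> locally bounded on \<open>S\<close> they are finite, so that \<open>real_of_ereal\<close> is harmless.\<close>

definition lower_env :: "'a::metric_space set \<Rightarrow> ('a \<Rightarrow> real) \<Rightarrow> 'a \<Rightarrow> real" where
  "lower_env S F x = real_of_ereal (Liminf (inf (nhds x) (principal S)) (\<lambda>y. ereal (F y)))"

definition upper_env :: "'a::metric_space set \<Rightarrow> ('a \<Rightarrow> real) \<Rightarrow> 'a \<Rightarrow> real" where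
  "upper_env S F x = real_of_ereal (Limsup (inf (nhds x) (principal S)) (\<lambda>y. ereal (F y)))"

definition usc_on :: "'a::metric_space set \<Rightarrow> ('a \<Rightarrow> real) \<Rightarrow> bool" where
  "usc_on S F \<longleftrightarrow> (\<forall>x\<in>S. Limsup (at x within S) (\<lambda>y. ereal (F y)) \<le> ereal (F x))"

definition lsc_on :: "'a::metric_space set \<Rightarrow> ('a \<Rightarrow> real) \<Rightarrow> bool" where
  "lsc_on S F \<longleftrightarrow> (\<forall>x\<in>S. ereal (F x) \<le> Liminf (at x within S) (\<lambda>y. ereal (F y)))"

section \<open>Function spaces\<close>

text \<open>Functions on \<open>[0,\<infinity>) \<times> \<real>\<close> are total functions on \<open>\<real> \<times> \<real>\<close>, of which only the
  restriction to \<open>halfspace\<close> matters.\<close>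

definition halfspace :: "(real \<times> real) set" where
  "halfspace = {0..} \<times> UNIV"

definition quasi_periodic :: "(real \<times> real \<Rightarrow> real) \<Rightarrow> bool" where
  "quasi_periodic F \<longleftrightarrow> (\<exists>a. \<forall>t\<ge>0. \<forall>x. F (t, x + 2 * pi) = F (t, x) + a)"

text \<open>The time derivative is one-sided at \<open>t = 0\<close>.\<close>

definition dt :: "(real \<times> real \<Rightarrow> real) \<Rightarrow> real \<times> real \<Rightarrow> real" where
  "dt \<phi> = (\<lambda>(t, x). vector_derivative (\<lambda>s. \<phi> (s, x)) (at t within {0..}))"

definition dx :: "(real \<times> real \<Rightarrow> real) \<Rightarrow> real \<times> real \<Rightarrow> real" where
  "dx \<phi> = (\<lambda>(t, x). deriv (\<lambda>y. \<phi> (t, y)) x)"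

definition C1_halfspace :: "(real \<times> real \<Rightarrow> real) \<Rightarrow> bool" where
  "C1_halfspace \<phi> \<longleftrightarrow>
     \<phi> differentiable_on halfspace \<and>
     continuous_on halfspace (dt \<phi>) \<and> continuous_on halfspace (dx \<phi>)"

definition test_function :: "(real \<times> real \<Rightarrow> real) \<Rightarrow> bool" where
  "test_function \<phi> \<longleftrightarrow>
     C1_halfspace \<phi> \<and> (\<exists>L. lipschitz_on L halfspace (dx \<phi>)) \<and> quasi_periodic \<phi>"

section \<open>The half-Laplacian and viscosity solutions\<close>

definition half_laplacian :: "(real \<Rightarrow> real) \<Rightarrow> real \<Rightarrow> real" where
  "half_laplacian f \<theta> =
     1 / (8 * pi) *
       (LINT \<theta>' : {-pi..pi} | lborel.
          (2 * f \<theta> - f (\<theta> - \<theta>') - f (\<theta> + \<theta>')) / (sin (\<theta>' / 2))\<^sup>2)"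

text \<open>If the space derivative is negative, the quotient below is a division by zero, with value
  \<open>0\<close>. This does not occur at the extrema considered below when the function under
  consideration satisfies \<open>F (t, \<theta> + h) - F (t, \<theta>) \<ge> m' * h\<close> with \<open>m' > 0\<close>.\<close>

definition pde_operator :: "(real \<times> real \<Rightarrow> real) \<Rightarrow> real \<Rightarrow> real \<Rightarrow> real" where
  "pde_operator \<phi> t \<theta> =
     dt \<phi> (t, \<theta>) +
     1 / pi * (arctan (half_laplacian (\<lambda>x. \<phi> (t, x)) \<theta> / max (dx \<phi> (t, \<theta>)) 0) + pi / 2)"

definition strict_max_at :: "(real \<times> real \<Rightarrow> real) \<Rightarrow> real \<Rightarrow> real \<Rightarrow> bool" where
  "strict_max_at u t\<^sub>0 \<theta>\<^sub>0 \<longleftrightarrow>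
     (\<forall>t\<ge>0. \<forall>\<theta>. u (t, \<theta>) \<le> u (t\<^sub>0, \<theta>\<^sub>0) \<and>
        (u (t, \<theta>) = u (t\<^sub>0, \<theta>\<^sub>0) \<longrightarrow> t = t\<^sub>0 \<and> (\<exists>k::int. \<theta> = \<theta>\<^sub>0 + 2 * pi * of_int k)))"

definition strict_min_at :: "(real \<times> real \<Rightarrow> real) \<Rightarrow> real \<Rightarrow> real \<Rightarrow> bool" where
  "strict_min_at u t\<^sub>0 \<theta>\<^sub>0 \<longleftrightarrow>
     (\<forall>t\<ge>0. \<forall>\<theta>. u (t, \<theta>) \<ge> u (t\<^sub>0, \<theta>\<^sub>0) \<and>
        (u (t, \<theta>) = u (t\<^sub>0, \<theta>\<^sub>0) \<longrightarrow> t = t\<^sub>0 \<and> (\<exists>k::int. \<theta> = \<theta>\<^sub>0 + 2 * pi * of_int k)))"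

definition viscosity_subsolution :: "(real \<times> real \<Rightarrow> real) \<Rightarrow> bool" where
  "viscosity_subsolution F \<longleftrightarrow>
     usc_on halfspace F \<and> quasi_periodic F \<and>
     (\<forall>\<phi> t\<^sub>0 \<theta>\<^sub>0. test_function \<phi> \<longrightarrow> t\<^sub>0 > 0 \<longrightarrow>
        strict_max_at (\<lambda>p. F p - \<phi> p) t\<^sub>0 \<theta>\<^sub>0 \<longrightarrow> dx \<phi> (t\<^sub>0, \<theta>\<^sub>0) \<noteq> 0 \<longrightarrow>
        pde_operator \<phi> t\<^sub>0 \<theta>\<^sub>0 \<le> 0)"

definition viscosity_supersolution :: "(real \<times> real \<Rightarrow> real) \<Rightarrow> bool" where
  "viscosity_supersolution F \<longleftrightarrow>
     lsc_on halfspace F \<and> quasi_periodic F \<and>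
     (\<forall>\<phi> t\<^sub>0 \<theta>\<^sub>0. test_function \<phi> \<longrightarrow> t\<^sub>0 > 0 \<longrightarrow>
        strict_min_at (\<lambda>p. F p - \<phi> p) t\<^sub>0 \<theta>\<^sub>0 \<longrightarrow> dx \<phi> (t\<^sub>0, \<theta>\<^sub>0) \<noteq> 0 \<longrightarrow>
        pde_operator \<phi> t\<^sub>0 \<theta>\<^sub>0 \<ge> 0)"

definition viscosity_solution :: "(real \<times> real \<Rightarrow> real) \<Rightarrow> bool" where
  "viscosity_solution F \<longleftrightarrow>
     locally_bounded_on halfspace F \<and>
     viscosity_subsolution F \<and> viscosity_supersolution (lower_env halfspace F)"

definition has_initial_condition :: "(real \<times> real \<Rightarrow> real) \<Rightarrow> (real \<Rightarrow> real) \<Rightarrow> bool" where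
  "has_initial_condition F F\<^sub>0 \<longleftrightarrow>
     (\<forall>\<theta>. upper_env halfspace F (0, \<theta>) \<le> upper_env UNIV F\<^sub>0 \<theta>) \<and>
     (\<forall>\<theta>. lower_env halfspace F (0, \<theta>) \<ge> lower_env UNIV F\<^sub>0 \<theta>)"

end

theory Submission
  imports Defs
begin

text \<open>Uniqueness follows from a comparison principle between a subsolution \<open>u\<close> and a supersolution
  \<open>v\<close>. If \<open>u - v\<close> had a positive value, then, after subtracting a strictly increasing function of
  time, doubling of variables with penalty \<open>K |p - q|\<^sup>2\<close> yields an interior maximum \<open>(p, q)\<close>. The
  sup-convolution of \<open>u\<close> and the inf-convolution of \<open>v\<close> then touch at the midpoint of \<open>p\<close> and \<open>q\<close>,
  and, being semiconvex and semiconcave, they can be separated by a single \<open>C\<^sup>1\<^sup>,\<^sup>1\<close> function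
  \<open>\<phi>\<close>. Translates of \<open>\<phi>\<close> are globally admissible test functions for \<open>u\<close> at \<open>p\<close> and for \<open>v\<close> at
  \<open>q\<close>, with the same space derivative and the same half-Laplacian, so the two viscosity inequalities
  contradict each other; the nonlocal integral never has to be split.\<close>

text \<open>The definition asks for global extrema against test functions that are C^1,1 over the
  whole period seen by the half-Laplacian, so functions that are smooth only near the contact point
  would not do. Their global construction is the interposition lemma of Ilmanen: a semiconvex
  function below a semiconcave one leaves room for a C^1,1 function between them. Global extrema
  also require control for large times, where nothing bounds the growth of \<open>u\<close> and
  \<open>v\<close>. The subtracted function of time must therefore outgrow an arbitrary sequence.
  The function class permits this, because a test function has a Lipschitz space derivative but only
  a continuous time derivative. The quotient inside the arctangent needs a positive space
  derivative. The lower slope bound of \<open>u\<close> passes to its test function, and the common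
  space derivative carries the positivity over to the test of \<open>v\<close>.\<close>

section \<open>Functions with bounded second differences\<close>

text \<open>Additivity alone gives homogeneity over the rationals. The bound on the unit ball,
  applied to \<open>n\<close> times a vector, makes \<open>T\<close> at most \<open>B / n\<close> on
  vectors of norm at most \<open>1 / n\<close>; approximating a real scalar by rationals then closes
  the gap.\<close>

lemma additive_bounded_imp_linear:
  fixes T :: "'a::real_normed_vector \<Rightarrow> real"
  assumes add: "\<And>v w. T (v + w) = T v + T w"
    and bdd: "\<And>v. norm v \<le> 1 \<Longrightarrow> \<bar>T v\<bar> \<le> B"
  shows "linear T"
proof (rule linearI)
  show "T (v + w) = T v + T w" for v w by (rule add)
  have T0: "T 0 = 0" using add[of 0 0] by simp
  have Tm: "T (- v) = - T v" for v using add[of v "-v"] T0 by simp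
  have Tn: "T (of_nat n *\<^sub>R v) = of_nat n * T v" for n v
    by (induction n) (simp_all add: T0 add scaleR_left_distrib algebra_simps)
  have small: "\<bar>T v\<bar> \<le> B / real n" if "n > 0" "norm v \<le> 1 / real n" for n v
  proof -
    have "\<bar>T (real n *\<^sub>R v)\<bar> \<le> B"
      using that by (intro bdd) (simp add: field_simps)
    then have "real n * \<bar>T v\<bar> \<le> B" using Tn[of n v] by (simp add: abs_mult)
    then show ?thesis using that by (simp add: field_simps)
  qed
  have rat: "T (c *\<^sub>R v) = c * T v" if "c \<in> \<rat>" for c v
  proof -
    have int: "T (of_int k *\<^sub>R v) = of_int k * T v" for k v
    proof (cases "k \<ge> 0")
      case True then show ?thesis using Tn[of "nat k" v] by simp
    next
      case False
      then show ?thesis using Tn[of "nat (-k)" v] Tm[of "of_int (-k) *\<^sub>R v"] by simp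
    qed
    obtain m n :: int where c: "c = of_int m / of_int n" "n \<noteq> 0" using \<open>c \<in> \<rat>\<close>
      by (metis Rats_cases' order_less_irrefl)
    have "of_int n * T (c *\<^sub>R v) = T (of_int n *\<^sub>R (c *\<^sub>R v))" by (simp only: int)
    also have "\<dots> = T (of_int m *\<^sub>R v)" using c by simp
    also have "\<dots> = of_int m * T v" by (rule int)
    finally have "of_int n * T (c *\<^sub>R v) = of_int n * (c * T v)" using c by simp
    then show ?thesis using c by (simp only: mult_cancel_left) simp
  qed
  show "T (c *\<^sub>R v) = c *\<^sub>R T v" for c v
  proof -
    have "\<bar>T (c *\<^sub>R v) - c * T v\<bar> \<le> (B + \<bar>T v\<bar>) / real n" if n: "n > 0" for n
    proof -
      \<comment> \<open>The summand 1 keeps both \<open>e\<close> and \<open>e * norm v\<close>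
        below \<open>1 / n\<close>, also for \<open>v = 0\<close>.\<close>
      define e where "e = 1 / (real n * (1 + norm v))"
      have e: "e > 0" unfolding e_def using n
        by (intro divide_pos_pos mult_pos_pos) (auto intro: add_pos_nonneg)
      obtain r where r: "r \<in> \<rat>" "c - e < r" "r < c + e"
        using Rats_dense_in_real[of "c - e" "c + e"] e by auto
      have ce: "\<bar>c - r\<bar> \<le> e" using r by auto
      have nv: "norm v \<ge> 0" by simp
      have "norm ((c - r) *\<^sub>R v) \<le> e * norm v" using ce by (simp add: mult_right_mono)
      also have "\<dots> \<le> 1 / real n"
        unfolding e_def using n nv by (simp add: field_simps add_pos_nonneg)
      finally have a: "\<bar>T ((c - r) *\<^sub>R v)\<bar> \<le> B / real n" using small n by blast
      have "e \<le> 1 / real n" unfolding e_def using n nv by (simp add: field_simps add_pos_nonneg)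
      then have b: "\<bar>(c - r) * T v\<bar> \<le> \<bar>T v\<bar> / real n"
        using ce mult_right_mono[of "\<bar>c-r\<bar>" "1 / real n" "\<bar>T v\<bar>"] by (simp add: abs_mult)
      have "T (c *\<^sub>R v) = T (r *\<^sub>R v) + T ((c - r) *\<^sub>R v)"
        using add[of "r *\<^sub>R v" "(c - r) *\<^sub>R v"] by (simp add: algebra_simps)
      then have "T (c *\<^sub>R v) - c * T v = T ((c - r) *\<^sub>R v) - (c - r) * T v"
        using rat[OF r(1), of v] by (simp add: algebra_simps)
      then show ?thesis using a b by (simp add: add_divide_distrib)
    qed
    then have "\<forall>n\<ge>1. \<bar>T (c *\<^sub>R v) - c * T v\<bar> \<le> (B + \<bar>T v\<bar>) / real n" by auto
    moreover have "(\<lambda>n. (B + \<bar>T v\<bar>) / real n) \<longlonglongrightarrow> 0" by (rule lim_const_over_n)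
    ultimately have "\<bar>T (c *\<^sub>R v) - c * T v\<bar> \<le> 0"
      by (intro tendsto_lowerbound[of _ 0 sequentially])
         (auto simp: eventually_sequentially)
    then show ?thesis by simp
  qed
qed

text \<open>Telescoping against a geometric series; the factor \<open>c / 2\<close> normalises its
  sum to \<open>c\<close>.\<close>

lemma dyadic_limit:
  fixes D :: "nat \<Rightarrow> real"
  assumes "\<And>n. \<bar>D (Suc n) - D n\<bar> \<le> c / 2 * (1/2) ^ n"
  obtains l where "D \<longlonglongrightarrow> l" "\<bar>l - D 0\<bar> \<le> c"
proof -
  have s: "summable (\<lambda>n. c / 2 * (1/2::real) ^ n)" by (intro summable_mult summable_geometric) simp
  have na: "summable (\<lambda>n. norm (D (Suc n) - D n))"
    by (rule summable_comparison_test'[OF s, of 0]) (use assms in auto)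
  then have "summable (\<lambda>n. D (Suc n) - D n)" by (rule summable_norm_cancel)
  then have "convergent D" by (simp add: telescope_summable' summable_iff_convergent sum_lessThan_telescope
        convergent_diff_const_right_iff)
  then obtain l where l: "D \<longlonglongrightarrow> l" by (auto simp: convergent_def)
  have "(\<Sum>n. D (Suc n) - D n) = l - D 0" using telescope_sums[OF l] by (simp add: sums_iff)
  moreover have "norm (\<Sum>n. D (Suc n) - D n) \<le> (\<Sum>n. c / 2 * (1/2) ^ n)"
    by (rule order_trans[OF summable_norm[OF na]]) (intro suminf_le na s, use assms in auto)
  moreover have "(\<Sum>n. c / 2 * (1/2::real) ^ n) = c"
    by (subst suminf_mult) (auto simp: suminf_geometric intro: summable_geometric)
  ultimately show thesis using that l by auto
qed

text \<open>The derivative at \<open>x\<close> in direction \<open>v\<close> is the limit of the difference quotients along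
  dyadic step sizes, which the second difference bound makes geometrically convergent.\<close>

lemma second_difference_bounded_imp_C11:
  fixes \<phi> :: "'a::euclidean_space \<Rightarrow> real"
  assumes sd: "\<And>x z. \<bar>\<phi> (x + z) + \<phi> (x - z) - 2 * \<phi> x\<bar> \<le> C * (norm z)\<^sup>2"
    and bdd: "\<And>x. bounded (\<phi> ` cball x 1)"
  obtains G where "\<And>x. (\<phi> has_derivative (\<lambda>h. G x \<bullet> h)) (at x)" "\<exists>L. L-lipschitz_on UNIV G"
proof -
  define D where "D = (\<lambda>x v (n::nat). 2^n * (\<phi> (x + (1/2)^n *\<^sub>R v) - \<phi> x))"
  have C0: "C \<ge> 0"
  proof -
    obtain z :: 'a where "norm z = 1" using SOME_Basis norm_Basis by blast
    then show ?thesis using sd[of 0 z] by simp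
  qed
  \<comment> \<open>The second difference centred at \<open>x + ?z\<close>, where \<open>?z\<close>
    is the halved step, compares two consecutive dyadic quotients.\<close>
  have Dstep: "\<bar>D x v (Suc n) - D x v n\<bar> \<le> (C * (norm v)\<^sup>2 / 2) / 2 * (1/2)^n" for x v n
  proof -
    let ?z = "(1/2)^(Suc n) *\<^sub>R v"
    have e: "x + ?z + ?z = x + (1/2)^n *\<^sub>R v"
      by (simp add: add.assoc scaleR_left_distrib[symmetric])
    have "\<bar>\<phi> (x + (1/2)^n *\<^sub>R v) + \<phi> x - 2 * \<phi> (x + ?z)\<bar> \<le> C * (norm ?z)\<^sup>2"
      using sd[of "x + ?z" ?z] by (simp only: e add_diff_cancel)
    then have "2^n * \<bar>\<phi> (x + (1/2)^n *\<^sub>R v) + \<phi> x - 2 * \<phi> (x + ?z)\<bar> \<le> 2^n * (C * (norm ?z)\<^sup>2)"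
      by (intro mult_left_mono) auto
    also have "2^n * (C * (norm ?z)\<^sup>2) = (C * (norm v)\<^sup>2 / 2) / 2 * (1/2)^n"
      by (simp add: power_mult_distrib power2_eq_square power_divide)
    finally have le: "2^n * \<bar>\<phi> (x + (1/2)^n *\<^sub>R v) + \<phi> x - 2 * \<phi> (x + ?z)\<bar> \<le> (C * (norm v)\<^sup>2 / 2) / 2 * (1/2)^n" .
    have "D x v (Suc n) = 2 * 2^n * (\<phi> (x + ?z) - \<phi> x)" by (simp add: D_def)
    then have "D x v (Suc n) - D x v n = - (2^n * (\<phi> (x + (1/2)^n *\<^sub>R v) + \<phi> x - 2 * \<phi> (x + ?z)))"
      by (simp add: D_def algebra_simps)
    then show ?thesis using le by (simp only: abs_minus_cancel abs_mult) simp
  qed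
  have "\<exists>l. D x v \<longlonglongrightarrow> l \<and> \<bar>l - D x v 0\<bar> \<le> C * (norm v)\<^sup>2 / 2" for x v
    using dyadic_limit[OF Dstep[of x v]] by blast
  then obtain T where T: "\<And>x v. D x v \<longlonglongrightarrow> T x v" "\<And>x v. \<bar>T x v - D x v 0\<bar> \<le> C * (norm v)\<^sup>2 / 2"
    by metis
  \<comment> \<open>\<open>D x v 0\<close> is the plain increment of \<phi>, so the distance from
    the limit to the starting value is a Taylor remainder.\<close>
  have exp: "\<bar>\<phi> (x + v) - \<phi> x - T x v\<bar> \<le> C * (norm v)\<^sup>2 / 2" for x v
    using T(2)[of x v] by (simp add: D_def abs_minus_commute)
  \<comment> \<open>The second difference centred at the midpoint of the steps along
    \<open>v\<close> and \<open>w\<close> is of order \<open>4^-n\<close>, so it tends to 0 even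
    after multiplication by \<open>2^n\<close>; its limit is also the defect of additivity.\<close>
  have add: "T x (v + w) = T x v + T x w" for x v w
  proof -
    let ?E = "\<lambda>n. 2^n * (2 * \<phi> (x + (1/2)^(Suc n) *\<^sub>R (v + w)) - \<phi> (x + (1/2)^n *\<^sub>R v) - \<phi> (x + (1/2)^n *\<^sub>R w))"
    have "?E = (\<lambda>n. D x (v + w) (Suc n) - D x v n - D x w n)"
      by (auto simp: D_def algebra_simps)
    moreover have "(\<lambda>n. D x (v + w) (Suc n) - D x v n - D x w n) \<longlonglongrightarrow> T x (v + w) - T x v - T x w"
      by (intro tendsto_diff T(1) LIMSEQ_Suc)
    moreover have "?E \<longlonglongrightarrow> 0"
    proof (rule Lim_null_comparison)
      show "(\<lambda>n. (C * (norm (v - w))\<^sup>2 / 4) * (1/2)^n) \<longlonglongrightarrow> 0"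
        by (intro tendsto_mult_right_zero LIMSEQ_power_zero) simp
      show "\<forall>\<^sub>F n in sequentially. norm (?E n) \<le> (C * (norm (v - w))\<^sup>2 / 4) * (1/2)^n"
      proof (intro always_eventually allI)
        fix n
        let ?x = "x + (1/2)^(Suc n) *\<^sub>R (v + w)" and ?z = "(1/2)^(Suc n) *\<^sub>R (v - w)"
        have half: "(1/2)^Suc n *\<^sub>R y + (1/2)^Suc n *\<^sub>R y = (1/2)^n *\<^sub>R y" for y :: 'a
          by (simp add: scaleR_left_distrib[symmetric])
        have e: "?x + ?z = x + (1/2)^n *\<^sub>R v" "?x - ?z = x + (1/2)^n *\<^sub>R w"
          using half[of v] half[of w] by (simp_all add: algebra_simps del: power_Suc)
        have "\<bar>\<phi> (x + (1/2)^n *\<^sub>R v) + \<phi> (x + (1/2)^n *\<^sub>R w) - 2 * \<phi> ?x\<bar> \<le> C * (norm ?z)\<^sup>2"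
          using sd[of ?x ?z] by (simp only: e)
        then have "2^n * \<bar>\<phi> (x + (1/2)^n *\<^sub>R v) + \<phi> (x + (1/2)^n *\<^sub>R w) - 2 * \<phi> ?x\<bar> \<le> 2^n * (C * (norm ?z)\<^sup>2)"
          by (intro mult_left_mono) auto
        also have "2^n * (C * (norm ?z)\<^sup>2) = (C * (norm (v - w))\<^sup>2 / 4) * (1/2)^n"
          by (simp add: power_mult_distrib power2_eq_square power_divide)
        finally show "norm (?E n) \<le> (C * (norm (v - w))\<^sup>2 / 4) * (1/2)^n"
          by (simp add: abs_mult del: power_Suc)
             (smt (verit) abs_minus_commute)
      qed
    qed
    ultimately show ?thesis using LIMSEQ_unique by fastforce
  qed
  have lin: "linear (T x)" for x
  proof -
    obtain B where B: "\<And>y. y \<in> cball x 1 \<Longrightarrow> \<bar>\<phi> y\<bar> \<le> B"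
      using bdd[of x] unfolding bounded_iff by (metis imageI real_norm_def)
    show ?thesis
    proof (rule additive_bounded_imp_linear[OF add])
      fix v :: 'a assume v: "norm v \<le> 1"
      have "C * (norm v)\<^sup>2 \<le> C * 1" using v C0 by (intro mult_left_mono power_le_one) auto
      moreover have "\<bar>\<phi> x\<bar> \<le> B" "\<bar>\<phi> (x + v)\<bar> \<le> B" using v by (auto intro!: B simp: dist_norm)
      ultimately show "\<bar>T x v\<bar> \<le> 2 * B + C"
        using exp[of x v] C0 unfolding abs_le_iff by simp
    qed
  qed
  define G where "G = (\<lambda>x. \<Sum>b\<in>Basis. T x b *\<^sub>R b)"
  have TG: "T x v = G x \<bullet> v" for x v
  proof -
    have "T x v = T x (\<Sum>b\<in>Basis. (v \<bullet> b) *\<^sub>R b)" by (simp add: euclidean_representation)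
    also have "\<dots> = (\<Sum>b\<in>Basis. (v \<bullet> b) * T x b)"
      using lin by (simp add: linear_sum linear_scale)
    finally show ?thesis by (simp add: G_def inner_sum_left inner_commute[of v] mult.commute)
  qed
  have der: "(\<phi> has_derivative (\<lambda>h. G x \<bullet> h)) (at x)" for x
  proof (rule has_derivativeI_sandwich[of 1])
    show "bounded_linear ((\<bullet>) (G x))" by (rule bounded_linear_inner_right)
    show "norm (\<phi> y - \<phi> x - G x \<bullet> (y - x)) / norm (y - x) \<le> C / 2 * norm (y - x)"
      if "y \<noteq> x" for y
      using exp[of x "y - x"] that by (simp add: TG field_simps power2_eq_square)
    show "((\<lambda>y. C / 2 * norm (y - x)) \<longlongrightarrow> 0) (at x)"
      by (intro tendsto_mult_right_zero) (auto intro!: tendsto_eq_intros)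
  qed auto
  \<comment> \<open>The same value \<open>\<phi> (y + v)\<close> is expanded at \<open>x\<close> and
    at \<open>y\<close>, with \<open>v\<close> along \<open>G y - G x\<close> and as long as
    \<open>y - x\<close>. The three remainders contribute 1/2, 2 and 1/2 times
    \<open>C * r\<^sup>2\<close>.\<close>
  have "dist (G x) (G y) \<le> 3 * C * dist x y" for x y
  proof (cases "G x = G y")
    case True then show ?thesis using C0 by simp
  next
    case False
    define r where "r = norm (y - x)"
    define v where "v = (r / norm (G y - G x)) *\<^sub>R (G y - G x)"
    have r0: "r > 0" using False by (auto simp: r_def)
    have nv: "norm v = r" using False r0 by (simp add: v_def)
    have "(norm (y - x + v))\<^sup>2 \<le> (2 * r)\<^sup>2"
      using norm_triangle_ineq[of "y - x" v] nv r0 by (intro power_mono) (auto simp: r_def)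
    then have a: "C * (norm (y - x + v))\<^sup>2 \<le> 4 * (C * r\<^sup>2)"
      using mult_left_mono[OF _ C0, of "(norm (y - x + v))\<^sup>2" "(2 * r)\<^sup>2"] by (simp add: power_mult_distrib)
    have "\<bar>G y \<bullet> v - G x \<bullet> v\<bar> \<le> C * r\<^sup>2 / 2 + 4 * (C * r\<^sup>2) / 2 + C * r\<^sup>2 / 2"
    proof -
      have "\<bar>\<phi> (y + v) - \<phi> y - G y \<bullet> v\<bar> \<le> C * r\<^sup>2 / 2"
        using exp[of y v] by (simp add: TG nv)
      moreover have "\<bar>\<phi> (y + v) - \<phi> x - (G x \<bullet> (y - x) + G x \<bullet> v)\<bar> \<le> 4 * (C * r\<^sup>2) / 2"
        using exp[of x "y - x + v"] a by (simp add: TG inner_add_right add.assoc[symmetric])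
      moreover have "\<bar>\<phi> y - \<phi> x - G x \<bullet> (y - x)\<bar> \<le> C * r\<^sup>2 / 2"
        using exp[of x "y - x"] by (simp add: TG r_def)
      ultimately show ?thesis by linarith
    qed
    moreover have "G y \<bullet> v - G x \<bullet> v = r * norm (G y - G x)"
      unfolding inner_diff_left[symmetric] v_def using False
      by (simp add: dot_square_norm power2_eq_square)
    ultimately have "r * norm (G y - G x) \<le> r * (3 * C * r)"
      by (simp add: power2_eq_square algebra_simps)
    then show ?thesis using r0 by (simp add: r_def dist_norm norm_minus_commute)
  qed
  then have "(3 * C)-lipschitz_on UNIV G" using C0 by (intro lipschitz_onI) auto
  then show thesis using that der by blast
qed

text \<open>The separating function is the largest semiconvex function below \<open>Z q' + K |p - q'|\<^sup>2\<close>.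
  Averaging two opposite translates of it and subtracting \<open>K |z|\<^sup>2\<close> gives a competitor, so
  maximality makes it semiconcave as well.\<close>

lemma C11_separation:
  fixes W Z :: "'a::euclidean_space \<Rightarrow> real"
  assumes K: "K \<ge> 0" and "S \<noteq> {}"
    and sep: "\<And>p q q'. q \<in> S \<Longrightarrow> q' \<in> S \<Longrightarrow>
          W q - K * (norm (p - q))\<^sup>2 \<le> Z q' + K * (norm (p - q'))\<^sup>2"
  obtains \<phi> G where
    "\<And>p q. q \<in> S \<Longrightarrow> W q - K * (norm (p - q))\<^sup>2 \<le> \<phi> p"
    "\<And>p q. q \<in> S \<Longrightarrow> \<phi> p \<le> Z q + K * (norm (p - q))\<^sup>2"
    "\<And>p. (\<phi> has_derivative (\<lambda>h. G p \<bullet> h)) (at p)" "\<exists>L. L-lipschitz_on UNIV G"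
    "\<And>d p. \<forall>q. q + d \<in> S \<longleftrightarrow> q \<in> S \<Longrightarrow> \<forall>q\<in>S. Z (q + d) = Z q \<Longrightarrow> \<phi> (p + d) = \<phi> p"
proof -
  have par: "(norm (a + z))\<^sup>2 + (norm (a - z))\<^sup>2 = 2 * (norm a)\<^sup>2 + 2 * (norm z)\<^sup>2" for a z :: 'a
    by (simp add: power2_norm_eq_inner algebra_simps inner_commute)
  define H where "H = {h :: 'a \<Rightarrow> real. (\<forall>x z. - (2 * K * (norm z)\<^sup>2) \<le> h (x + z) + h (x - z) - 2 * h x) \<and>
      (\<forall>p. \<forall>q\<in>S. h p \<le> Z q + K * (norm (p - q))\<^sup>2)}"
  define \<phi> where "\<phi> = (\<lambda>p. SUP h\<in>H. h p)"
  obtain q0 where q0: "q0 \<in> S" using \<open>S \<noteq> {}\<close> by blast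
  have WH: "(\<lambda>p. W q - K * (norm (p - q))\<^sup>2) \<in> H" if "q \<in> S" for q
  proof -
    have "- (2 * K * (norm z)\<^sup>2) \<le> (W q - K * (norm (x + z - q))\<^sup>2) + (W q - K * (norm (x - z - q))\<^sup>2)
        - 2 * (W q - K * (norm (x - q))\<^sup>2)" for x z
      using arg_cong[OF par[of "x - q" z], of "\<lambda>t. K * t"] by (simp add: algebra_simps)
    then show ?thesis using sep that by (simp add: H_def)
  qed
  have Hle: "h p \<le> Z q + K * (norm (p - q))\<^sup>2" if "h \<in> H" "q \<in> S" for h p q
    using that by (simp add: H_def)
  have bdd: "bdd_above ((\<lambda>h. h p) ` H)" for p
    by (rule bdd_aboveI2) (use Hle q0 in blast)
  have Hphi: "h p \<le> \<phi> p" if "h \<in> H" for h p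
    unfolding \<phi>_def by (rule cSUP_upper[OF that bdd])
  have ne: "H \<noteq> {}" using WH q0 by blast
  have low: "W q - K * (norm (p - q))\<^sup>2 \<le> \<phi> p" if "q \<in> S" for p q
    using Hphi[OF WH[OF that]] .
  have up: "\<phi> p \<le> Z q + K * (norm (p - q))\<^sup>2" if "q \<in> S" for p q
    unfolding \<phi>_def by (rule cSUP_least[OF ne]) (use Hle that in blast)
  have cvx: "- (2 * K * (norm z)\<^sup>2) \<le> \<phi> (x + z) + \<phi> (x - z) - 2 * \<phi> x" for x z
  proof -
    have "\<phi> x \<le> (2 * K * (norm z)\<^sup>2 + \<phi> (x + z) + \<phi> (x - z)) / 2"
      unfolding \<phi>_def[THEN fun_cong, of x]
    proof (rule cSUP_least[OF ne])
      fix h assume "h \<in> H"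
      then have "- (2 * K * (norm z)\<^sup>2) \<le> h (x + z) + h (x - z) - 2 * h x" by (simp add: H_def)
      then have "2 * h x \<le> 2 * K * (norm z)\<^sup>2 + \<phi> (x + z) + \<phi> (x - z)"
        using Hphi[OF \<open>h \<in> H\<close>, of "x + z"] Hphi[OF \<open>h \<in> H\<close>, of "x - z"] by linarith
      then show "h x \<le> (2 * K * (norm z)\<^sup>2 + \<phi> (x + z) + \<phi> (x - z)) / 2" by simp
    qed
    then show ?thesis by simp
  qed
  have conc: "\<phi> (x + z) + \<phi> (x - z) - 2 * \<phi> x \<le> 2 * K * (norm z)\<^sup>2" for x z
  proof -
    define w where "w = (\<lambda>y. (\<phi> (y + z) + \<phi> (y - z)) / 2 - K * (norm z)\<^sup>2)"
    have "- (2 * K * (norm z')\<^sup>2) \<le> w (y + z') + w (y - z') - 2 * w y" for y z'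
      using cvx[of z' "y + z"] cvx[of z' "y - z"] unfolding w_def
      by (simp add: algebra_simps add_divide_distrib)
    moreover have "w p \<le> Z q + K * (norm (p - q))\<^sup>2" if "q \<in> S" for p q
      using up[OF that, of "p + z"] up[OF that, of "p - z"]
        arg_cong[OF par[of "p - q" z], of "\<lambda>t. K * t"] unfolding w_def
      by (simp add: algebra_simps)
    ultimately have "w \<in> H" by (simp add: H_def)
    from Hphi[OF this, of x] show ?thesis by (simp add: w_def field_simps)
  qed
  \<comment> \<open>The two paraboloids centred at \<open>q0\<close> enclose \<phi>. Local
    boundedness is what makes the additive directional derivatives linear.\<close>
  have "bounded (\<phi> ` cball x 1)" for x
  proof -
    define R where "R = norm (x - q0) + 1"
    have "\<bar>\<phi> p\<bar> \<le> \<bar>W q0\<bar> + \<bar>Z q0\<bar> + K * R\<^sup>2" if "p \<in> cball x 1" for p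
    proof -
      have "norm (p - q0) \<le> R" using that norm_triangle_ineq[of "p - x" "x - q0"]
        by (simp add: R_def dist_norm norm_minus_commute)
      then have "K * (norm (p - q0))\<^sup>2 \<le> K * R\<^sup>2" by (intro mult_left_mono power_mono K) auto
      then show ?thesis using low[OF q0, of p] up[OF q0, of p] by linarith
    qed
    then show ?thesis by (intro boundedI[where B = "\<bar>W q0\<bar> + \<bar>Z q0\<bar> + K * R\<^sup>2"]) auto
  qed
  moreover have "\<bar>\<phi> (x + z) + \<phi> (x - z) - 2 * \<phi> x\<bar> \<le> 2 * K * (norm z)\<^sup>2" for x z
    using conc[of x z] cvx[of z x] by linarith
  ultimately obtain G where G: "\<And>p. (\<phi> has_derivative (\<lambda>h. G p \<bullet> h)) (at p)" "\<exists>L. L-lipschitz_on UNIV G"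
    using second_difference_bounded_imp_C11[of \<phi> "2 * K"] by blast
  \<comment> \<open>A translate by \<open>d\<close> of a competitor is again a competitor when
    \<open>S\<close> and \<open>Z\<close> are invariant; \<open>d\<close> and \<open>- d\<close>
    together give equality.\<close>
  have mono: "\<phi> p \<le> \<phi> (p + d)"
    if d: "\<And>q. q + d \<in> S \<longleftrightarrow> q \<in> S" "\<And>q. q \<in> S \<Longrightarrow> Z (q + d) = Z q" for d p
    unfolding \<phi>_def[THEN fun_cong, of p]
  proof (rule cSUP_least[OF ne])
    fix h assume h: "h \<in> H"
    have "- (2 * K * (norm z)\<^sup>2) \<le> h (x + z - d) + h (x - z - d) - 2 * h (x - d)" for x z
    proof -
      have "x + z - d = x - d + z" "x - z - d = x - d - z" by simp_all
      then show ?thesis using h unfolding H_def by (metis (no_types, lifting) mem_Collect_eq)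
    qed
    moreover have "h (p - d) \<le> Z q + K * (norm (p - q))\<^sup>2" if "q \<in> S" for p q
    proof -
      have "q - d \<in> S" using d(1)[of "q - d"] that by simp
      then show ?thesis using Hle[OF h, of "q - d" "p - d"] d(2)[of "q - d"] by simp
    qed
    ultimately have "(\<lambda>x. h (x - d)) \<in> H" by (simp add: H_def)
    from Hphi[OF this, of "p + d"] show "h p \<le> \<phi> (p + d)" by simp
  qed
  have inv: "\<phi> (p + d) = \<phi> p"
    if d: "\<And>q. q + d \<in> S \<longleftrightarrow> q \<in> S" "\<And>q. q \<in> S \<Longrightarrow> Z (q + d) = Z q" for d p
  proof (rule antisym)
    have i: "q + - d \<in> S \<longleftrightarrow> q \<in> S" for q using d(1)[of "q - d"] by simp
    moreover have "Z (q + - d) = Z q" if "q \<in> S" for q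
      using d(2)[of "q - d"] i[of q] that by simp
    ultimately show "\<phi> (p + d) \<le> \<phi> p" using mono[of "- d" "p + d"] by simp
  qed (rule mono[OF d])
  show thesis
  proof (rule that[of \<phi> G])
    show "\<phi> (p + d) = \<phi> p" if "\<forall>q. q + d \<in> S \<longleftrightarrow> q \<in> S" "\<forall>q\<in>S. Z (q + d) = Z q" for d p
      by (rule inv) (use that in auto)
  qed (use low up G in auto)
qed

section \<open>The half-Laplacian\<close>

text \<open>The mean value theorem on either side of \<open>x\<close> yields derivatives at points
  less than \<open>2 * h\<close> apart for \<open>h > 0\<close>, hence the factor 2.\<close>

lemma second_difference_le_of_lipschitz_deriv:
  fixes f :: "real \<Rightarrow> real"
  assumes der: "\<And>x. (f has_real_derivative f' x) (at x)" and lip: "L-lipschitz_on UNIV f'"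
  shows "\<bar>2 * f x - f (x - h) - f (x + h)\<bar> \<le> 2 * L * h\<^sup>2"
proof -
  have *: "\<bar>2 * f x - f (x - h) - f (x + h)\<bar> \<le> 2 * L * h\<^sup>2" if h: "h > 0" for h
  proof -
    obtain a where a: "x < a" "a < x + h" "f (x + h) - f x = (x + h - x) * f' a"
      using MVT2[of x "x + h" f f'] h der by auto
    obtain b where b: "x - h < b" "b < x" "f x - f (x - h) = (x - (x - h)) * f' b"
      using MVT2[of "x - h" x f f'] h der by auto
    have L: "L \<ge> 0" using lip by (rule lipschitz_on_nonneg)
    have "\<bar>f' b - f' a\<bar> \<le> L * \<bar>b - a\<bar>" using lipschitz_onD[OF lip, of b a] by (simp add: dist_real_def)
    also have "\<dots> \<le> L * (2 * h)" using a b L by (intro mult_left_mono) auto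
    finally have "h * \<bar>f' b - f' a\<bar> \<le> h * (L * (2 * h))" using h by (intro mult_left_mono) auto
    moreover have "2 * f x - f (x - h) - f (x + h) = h * (f' b - f' a)"
      using a(3) b(3) by (simp add: algebra_simps)
    ultimately show ?thesis using h by (simp add: abs_mult power2_eq_square mult.left_commute)
  qed
  consider "h > 0" | "h = 0" | "- h > 0" by linarith
  then show ?thesis
  proof cases
    case 3 then show ?thesis using *[of "- h"] by (simp add: algebra_simps)
  qed (use * in auto)
qed

text \<open>Doubling the angle \<open>h / 4\<close> and bounding the cosine below by
  \<open>sqrt 2 / 2\<close> on \<open>[0, pi / 4]\<close> gives
  \<open>\<bar>h\<bar> / 4 \<le> sin (\<bar>h\<bar> / 2)\<close>. This bounds the kernel of the
  half-Laplacian by \<open>16 / h\<^sup>2\<close>.\<close>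

lemma sin_half_sq_ge:
  fixes h :: real
  assumes "\<bar>h\<bar> \<le> pi"
  shows "h\<^sup>2 / 16 \<le> (sin (h / 2))\<^sup>2"
proof -
  have *: "h / 4 \<le> sin (h / 2)" if h: "0 \<le> h" "h \<le> pi" for h :: real
  proof -
    have c: "sqrt 2 / 2 \<le> cos z" if "0 \<le> z" "z \<le> h / 4" for z
      using cos_monotone_0_pi_le[of z "pi / 4"] that h pi_gt_zero by (simp add: cos_45)
    have s: "h / 4 * (sqrt 2 / 2) \<le> sin (h / 4)"
    proof (cases "h = 0")
      case False
      then have "0 < h / 4" using h by simp
      then obtain z where z: "0 < z" "z < h / 4" "sin (h / 4) - sin 0 = (h / 4 - 0) * cos z"
        using MVT2[of 0 "h / 4" sin cos] DERIV_sin by blast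
      then have "h / 4 * (sqrt 2 / 2) \<le> h / 4 * cos z" using h c by (intro mult_left_mono) auto
      also have "\<dots> = sin (h / 4)" using z by simp
      finally show ?thesis .
    qed simp
    have "0 \<le> sin (h / 4)" using h by (intro sin_ge_zero) auto
    then have "h / 4 * (sqrt 2 / 2) * (sqrt 2 / 2) \<le> sin (h / 4) * cos (h / 4)"
      using h by (intro mult_mono[OF s c]) auto
    moreover have "sin (h / 2) = 2 * sin (h / 4) * cos (h / 4)" using sin_double[of "h / 4"] by simp
    moreover have "h / 4 * (sqrt 2 / 2) * (sqrt 2 / 2) = h / 8"
      by (simp add: mult.assoc)
    ultimately show ?thesis by linarith
  qed
  have "\<bar>h\<bar> / 4 \<le> sin (\<bar>h\<bar> / 2)" using *[of "\<bar>h\<bar>"] assms by simp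
  then have "(\<bar>h\<bar> / 4)\<^sup>2 \<le> (sin (\<bar>h\<bar> / 2))\<^sup>2" by (intro power_mono) auto
  then show ?thesis by (cases "h \<ge> 0") (auto simp: power_divide)
qed

text \<open>The second difference is at most \<open>2 * L * h\<^sup>2\<close>, the kernel at most
  \<open>16 / h\<^sup>2\<close>, so the integrand is bounded by \<open>32 * L\<close>; where the
  sine vanishes, division by zero gives 0. Integrability is needed because the integral is additive
  only on integrable functions.\<close>

lemma half_laplacian_integrable:
  fixes f :: "real \<Rightarrow> real"
  assumes der: "\<And>x. (f has_real_derivative f' x) (at x)" and lip: "L-lipschitz_on UNIV f'"
  shows "set_integrable lborel {-pi..pi}
           (\<lambda>h. (2 * f \<theta> - f (\<theta> - h) - f (\<theta> + h)) / (sin (h / 2))\<^sup>2)"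
proof -
  have L: "L \<ge> 0" using lip by (rule lipschitz_on_nonneg)
  have cont: "continuous_on A f" for A
    using der by (meson DERIV_isCont continuous_at_imp_continuous_on)
  have [measurable]: "f \<in> borel_measurable borel" by (rule borel_measurable_continuous_onI[OF cont])
  have "\<bar>(2 * f \<theta> - f (\<theta> - h) - f (\<theta> + h)) / (sin (h / 2))\<^sup>2\<bar> \<le> 32 * L" if "\<bar>h\<bar> \<le> pi" for h
  proof (cases "sin (h / 2) = 0")
    case False
    have "\<bar>2 * f \<theta> - f (\<theta> - h) - f (\<theta> + h)\<bar> \<le> 32 * L * (h\<^sup>2 / 16)"
      using second_difference_le_of_lipschitz_deriv[OF der lip, of \<theta> h] by simp
    also have "\<dots> \<le> 32 * L * (sin (h / 2))\<^sup>2"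
      using sin_half_sq_ge[OF that] L by (intro mult_left_mono) auto
    finally show ?thesis using False by (simp add: divide_le_eq abs_mult)
  qed (use L in auto)
  then show ?thesis unfolding set_integrable_def
    by (intro integrableI_bounded_set_indicator[where B = "32 * L"])
       (auto simp: abs_le_iff)
qed

lemma half_laplacian_add_scaled:
  assumes f: "\<And>x. (f has_real_derivative f' x) (at x)" "L-lipschitz_on UNIV f'"
    and g: "\<And>x. (g has_real_derivative g' x) (at x)" "M-lipschitz_on UNIV g'"
  shows "half_laplacian (\<lambda>x. f x + c * g x) \<theta> = half_laplacian f \<theta> + c * half_laplacian g \<theta>"
proof -
  have eq: "(2 * (f \<theta> + c * g \<theta>) - (f (\<theta> - h) + c * g (\<theta> - h)) - (f (\<theta> + h) + c * g (\<theta> + h))) / (sin (h / 2))\<^sup>2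
     = (2 * f \<theta> - f (\<theta> - h) - f (\<theta> + h)) / (sin (h / 2))\<^sup>2 + c * ((2 * g \<theta> - g (\<theta> - h) - g (\<theta> + h)) / (sin (h / 2))\<^sup>2)" for h
    by (cases "sin (h / 2) = 0") (simp_all add: field_simps)
  note i = half_laplacian_integrable[OF f, of \<theta>] half_laplacian_integrable[OF g, of \<theta>]
  show ?thesis
    unfolding half_laplacian_def eq set_integral_add(2)[OF i(1) set_integrable_mult_right[OF i(2)]]
      set_integral_mult_right
    by (simp only: distrib_left mult.left_commute)
qed

section \<open>Testing with non-strict extrema\<close>

text \<open>The gradient is an explicit parameter and lives on the whole plane, so one-sided
  derivatives at time 0 enter only through \<open>dt\<close>. The time part is merely continuous,
  which leaves room for functions of time of any growth.\<close>

definition C11_with_gradient ::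
    "(real \<times> real \<Rightarrow> real) \<Rightarrow> (real \<times> real \<Rightarrow> real) \<Rightarrow> (real \<times> real \<Rightarrow> real) \<Rightarrow> bool" where
  "C11_with_gradient \<Phi> \<Phi>t \<Phi>x \<longleftrightarrow>
     (\<forall>p. (\<Phi> has_derivative (\<lambda>h. fst h * \<Phi>t p + snd h * \<Phi>x p)) (at p)) \<and>
     continuous_on UNIV \<Phi>t \<and> (\<exists>L. L-lipschitz_on UNIV \<Phi>x)"

lemma C11_has_derivative:
    "C11_with_gradient \<Phi> \<Phi>t \<Phi>x \<Longrightarrow> (\<Phi> has_derivative (\<lambda>h. fst h * \<Phi>t p + snd h * \<Phi>x p)) (at p)"
  and C11_continuous: "C11_with_gradient \<Phi> \<Phi>t \<Phi>x \<Longrightarrow> continuous_on UNIV \<Phi>t"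
  and C11_lipschitz: "C11_with_gradient \<Phi> \<Phi>t \<Phi>x \<Longrightarrow> \<exists>L. L-lipschitz_on UNIV \<Phi>x"
  unfolding C11_with_gradient_def by blast+

context
  fixes \<Phi> \<Phi>t \<Phi>x :: "real \<times> real \<Rightarrow> real"
  assumes C11: "C11_with_gradient \<Phi> \<Phi>t \<Phi>x"
begin

lemma C11_deriv_t: "((\<lambda>s. \<Phi> (s, x)) has_real_derivative \<Phi>t (t, x)) (at t)"
proof -
  have "(\<Phi> has_derivative (\<lambda>h. fst h * \<Phi>t (t, x) + snd h * \<Phi>x (t, x))) (at (t, x))"
    by (rule C11_has_derivative[OF C11])
  moreover have "((\<lambda>s. (s, x)) has_derivative (\<lambda>h. (h, 0))) (at t)"
    by (auto intro!: derivative_eq_intros)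
  ultimately have "((\<lambda>s. \<Phi> (s, x)) has_derivative (\<lambda>h. h * \<Phi>t (t, x))) (at t)"
    using has_derivative_compose[of "\<lambda>s. (s, x)" "\<lambda>h. (h, 0)" t UNIV \<Phi>] by fastforce
  then show ?thesis by (simp add: has_field_derivative_def mult_commute_abs)
qed

lemma C11_deriv_x: "((\<lambda>y. \<Phi> (t, y)) has_real_derivative \<Phi>x (t, x)) (at x)"
proof -
  have "(\<Phi> has_derivative (\<lambda>h. fst h * \<Phi>t (t, x) + snd h * \<Phi>x (t, x))) (at (t, x))"
    by (rule C11_has_derivative[OF C11])
  moreover have "((\<lambda>y. (t, y)) has_derivative (\<lambda>h. (0, h))) (at x)"
    by (auto intro!: derivative_eq_intros)
  ultimately have "((\<lambda>y. \<Phi> (t, y)) has_derivative (\<lambda>h. h * \<Phi>x (t, x))) (at x)"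
    using has_derivative_compose[of "\<lambda>y. (t, y)" "\<lambda>h. (0, h)" x UNIV \<Phi>] by fastforce
  then show ?thesis by (simp add: has_field_derivative_def mult_commute_abs)
qed

lemma C11_dx_eq: "dx \<Phi> = \<Phi>x"
  using C11_deriv_x by (auto simp: dx_def DERIV_imp_deriv)

lemma C11_dt_eq: "t \<ge> 0 \<Longrightarrow> dt \<Phi> (t, x) = \<Phi>t (t, x)"
proof -
  assume t: "t \<ge> 0"
  have "((\<lambda>s. \<Phi> (s, x)) has_vector_derivative \<Phi>t (t, x)) (at t within {0..})"
    using C11_deriv_t[THEN DERIV_subset[of _ _ _ UNIV "{0..}"]]
    by (simp add: has_real_derivative_iff_has_vector_derivative)
  \<comment> \<open>A derivative within \<open>{0..}\<close> is unique because every
    \<open>t \<ge> 0\<close>, even 0, is a limit of larger times.\<close>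
  moreover have "at t within {0..} \<noteq> bot"
  proof -
    have "t \<in> closure ({0..} - {t})"
    proof (rule closure_mono[THEN subsetD])
      show "{t<..} \<subseteq> {0..} - {t}" using t by auto
    qed simp
    then show ?thesis by (simp add: at_within_eq_bot_iff)
  qed
  ultimately show ?thesis by (simp add: dt_def vector_derivative_within)
qed

lemma C11_lipschitz_slice: "\<exists>L. L-lipschitz_on UNIV (\<lambda>x. \<Phi>x (t, x))"
proof -
  obtain L where "L-lipschitz_on UNIV \<Phi>x" using C11_lipschitz[OF C11] by blast
  then have "L-lipschitz_on UNIV (\<lambda>x. \<Phi>x (t, x))"
    using lipschitz_onD[of L UNIV \<Phi>x "(t, _)" "(t, _)"] lipschitz_on_nonneg
    by (intro lipschitz_onI) (auto simp: dist_Pair_Pair)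
  then show ?thesis ..
qed

lemma C11_test_function:
  assumes per: "\<And>t x. \<Phi> (t, x + 2 * pi) = \<Phi> (t, x) + a"
  shows "test_function \<Phi>"
proof -
  have "\<Phi> differentiable_on halfspace"
    unfolding differentiable_on_def
    using C11_has_derivative[OF C11] by (blast intro: differentiableI differentiable_at_withinI)
  moreover have "continuous_on halfspace (dt \<Phi>)"
  proof (subst continuous_on_cong[OF refl])
    show "dt \<Phi> p = \<Phi>t p" if "p \<in> halfspace" for p
      using that C11_dt_eq by (cases p) (auto simp: halfspace_def)
    show "continuous_on halfspace \<Phi>t"
      using C11_continuous[OF C11] continuous_on_subset by blast
  qed
  moreover obtain L where L: "L-lipschitz_on UNIV \<Phi>x" using C11_lipschitz[OF C11] by blast
  then have "L-lipschitz_on halfspace (dx \<Phi>)" "continuous_on halfspace (dx \<Phi>)"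
    unfolding C11_dx_eq using lipschitz_on_subset lipschitz_on_continuous_on by blast+
  ultimately show ?thesis
    using per by (auto simp: test_function_def C1_halfspace_def quasi_periodic_def)
qed

end

lemma C11_add:
  assumes "C11_with_gradient \<Phi> \<Phi>t \<Phi>x" "C11_with_gradient \<Psi> \<Psi>t \<Psi>x"
  shows "C11_with_gradient (\<lambda>p. \<Phi> p + c * \<Psi> p) (\<lambda>p. \<Phi>t p + c * \<Psi>t p) (\<lambda>p. \<Phi>x p + c * \<Psi>x p)"
proof -
  have "((\<lambda>p. \<Phi> p + c * \<Psi> p) has_derivative
      (\<lambda>h. fst h * (\<Phi>t p + c * \<Psi>t p) + snd h * (\<Phi>x p + c * \<Psi>x p))) (at p)" for p
  proof (rule has_derivative_eq_rhs)
    show "((\<lambda>p. \<Phi> p + c * \<Psi> p) has_derivative (\<lambda>h. (fst h * \<Phi>t p + snd h * \<Phi>x p)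
        + c * (fst h * \<Psi>t p + snd h * \<Psi>x p))) (at p)"
      by (intro has_derivative_add has_derivative_mult_right C11_has_derivative assms)
  qed (auto simp: algebra_simps)
  moreover obtain L M where "L-lipschitz_on UNIV \<Phi>x" "M-lipschitz_on UNIV \<Psi>x"
    using assms C11_lipschitz by blast
  then have "(L + \<bar>c\<bar> * M)-lipschitz_on UNIV (\<lambda>p. \<Phi>x p + c * \<Psi>x p)"
    by (intro lipschitz_on_add lipschitz_on_cmult_real)
  moreover have "continuous_on UNIV (\<lambda>p. \<Phi>t p + c * \<Psi>t p)"
    using assms by (intro continuous_intros C11_continuous)
  ultimately show ?thesis unfolding C11_with_gradient_def by blast
qed

text \<open>Adding a small multiple of this function turns a global extremum into a strict one without
  changing the gradient at \<open>(t0, x0)\<close>.\<close>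

definition strictifier :: "real \<Rightarrow> real \<Rightarrow> real \<times> real \<Rightarrow> real" where
  "strictifier t0 x0 p = (fst p - t0)\<^sup>2 + (1 - cos (snd p - x0))"

lemma strictifier_C11:
  "C11_with_gradient (strictifier t0 x0) (\<lambda>p. 2 * (fst p - t0)) (\<lambda>p. sin (snd p - x0))"
proof -
  have "(strictifier t0 x0 has_derivative
      (\<lambda>h. fst h * (2 * (fst p - t0)) + snd h * sin (snd p - x0))) (at p)" for p
    unfolding strictifier_def by (auto intro!: derivative_eq_intros simp: fun_eq_iff)
  moreover have "1-lipschitz_on UNIV (\<lambda>p :: real \<times> real. sin (snd p - x0))"
  proof (rule lipschitz_onI)
    fix p q :: "real \<times> real"
    have "\<bar>sin (snd p - x0) - sin (snd q - x0)\<bar> = 2 * \<bar>sin ((snd p - snd q) / 2)\<bar> * \<bar>cos ((snd p - x0 + (snd q - x0)) / 2)\<bar>"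
      by (simp add: sin_diff_sin abs_mult)
    also have "\<dots> \<le> 2 * \<bar>(snd p - snd q) / 2\<bar> * 1"
      by (intro mult_mono abs_sin_x_le_abs_x abs_cos_le_one) auto
    finally show "dist (sin (snd p - x0)) (sin (snd q - x0)) \<le> 1 * dist p q"
      using dist_snd_le[of p q] by (simp add: dist_real_def)
  qed simp
  moreover have "continuous_on UNIV (\<lambda>p :: real \<times> real. 2 * (fst p - t0))"
    by (intro continuous_intros)
  ultimately show ?thesis unfolding C11_with_gradient_def by blast
qed

lemma strictifier_nonneg: "strictifier t0 x0 p \<ge> 0"
  by (simp add: strictifier_def)

lemma strictifier_periodic: "strictifier t0 x0 (t, x + 2 * pi) = strictifier t0 x0 (t, x)"
proof -
  have "x + 2 * pi - x0 = x - x0 + 2 * pi" by simp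
  then show ?thesis unfolding strictifier_def snd_conv fst_conv by (simp only: cos_periodic)
qed

lemma strictifier_eq_0_iff:
  "strictifier t0 x0 (t, x) = 0 \<longleftrightarrow> t = t0 \<and> (\<exists>k::int. x = x0 + 2 * pi * of_int k)"
proof -
  have "strictifier t0 x0 (t, x) = 0 \<longleftrightarrow> (t - t0)\<^sup>2 = 0 \<and> 1 - cos (x - x0) = 0"
    unfolding strictifier_def by (subst add_nonneg_eq_0_iff) auto
  then show ?thesis by (auto simp: cos_one_2pi_int algebra_simps)
qed

text \<open>Both partial derivatives of the strictifier vanish at \<open>(t0, x0)\<close>, so its
  multiple enters only through the half-Laplacian, linearly in \<open>c\<close>. Positivity of
  \<open>\<Phi>x (t0, x0)\<close> removes the positive part in the denominator.\<close>

lemma pde_operator_strictified: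
  assumes C11: "C11_with_gradient \<Phi> \<Phi>t \<Phi>x" and t0: "t0 > 0" and pos: "\<Phi>x (t0, x0) > 0"
  shows "pde_operator (\<lambda>p. \<Phi> p + c * strictifier t0 x0 p) t0 x0 =
    \<Phi>t (t0, x0) + 1 / pi * (arctan ((half_laplacian (\<lambda>x. \<Phi> (t0, x)) x0
       + c * half_laplacian (\<lambda>x. strictifier t0 x0 (t0, x)) x0) / \<Phi>x (t0, x0)) + pi / 2)"
proof -
  note S = strictifier_C11[of t0 x0]
  note A = C11_add[OF C11 S, of c]
  obtain L M where "L-lipschitz_on UNIV (\<lambda>x. \<Phi>x (t0, x))" "M-lipschitz_on UNIV (\<lambda>x. sin (x - x0))"
    using C11_lipschitz_slice[OF C11, of t0] C11_lipschitz_slice[OF S, of t0] by auto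
  then show ?thesis
    using half_laplacian_add_scaled[OF C11_deriv_x[OF C11] _ C11_deriv_x[OF S], of L t0 M t0 c x0] pos
    unfolding pde_operator_def C11_dx_eq[OF A] C11_dt_eq[OF A less_imp_le[OF t0]] by simp
qed

lemma pde_value_tendsto:
  assumes "b > 0"
  shows "((\<lambda>c. d + 1 / pi * (arctan ((A + c * B) / b) + pi / 2)) \<longlongrightarrow>
     d + 1 / pi * (arctan (A / b) + pi / 2)) (at (0::real) within S)"
  using assms by (auto intro!: tendsto_eq_intros)

text \<open>Adding \<open>c\<close> times the strictifier with \<open>c > 0\<close> makes the
  contact strict up to periods. The inequality survives as \<open>c\<close> tends to 0 because the
  denominator stays fixed and positive.\<close>

lemma subsolution_test:
  assumes u: "viscosity_subsolution u" and C11: "C11_with_gradient \<Phi> \<Phi>t \<Phi>x"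
    and per: "\<And>t x. \<Phi> (t, x + 2 * pi) = \<Phi> (t, x) + a"
    and t0: "t0 > 0" and pos: "\<Phi>x (t0, x0) > 0"
    and le: "\<And>t x. t \<ge> 0 \<Longrightarrow> u (t, x) \<le> \<Phi> (t, x)" and eq: "u (t0, x0) = \<Phi> (t0, x0)"
  shows "\<Phi>t (t0, x0) + 1 / pi *
     (arctan (half_laplacian (\<lambda>x. \<Phi> (t0, x)) x0 / \<Phi>x (t0, x0)) + pi / 2) \<le> 0"
proof -
  have "pde_operator (\<lambda>p. \<Phi> p + c * strictifier t0 x0 p) t0 x0 \<le> 0" if c: "c > 0" for c
  proof -
    let ?\<Psi> = "\<lambda>p. \<Phi> p + c * strictifier t0 x0 p"
    note A = C11_add[OF C11 strictifier_C11[of t0 x0], of c]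
    have "test_function ?\<Psi>"
      by (rule C11_test_function[OF A, of a])
        (simp add: per strictifier_periodic)
    moreover have "dx ?\<Psi> (t0, x0) \<noteq> 0" using pos by (simp add: C11_dx_eq[OF A])
    moreover have "strict_max_at (\<lambda>p. u p - ?\<Psi> p) t0 x0"
      unfolding strict_max_at_def
    proof (intro allI impI conjI)
      fix t x :: real assume t: "t \<ge> 0"
      have z: "strictifier t0 x0 (t0, x0) = 0" by (simp add: strictifier_def)
      have n: "c * strictifier t0 x0 (t, x) \<ge> 0" using c strictifier_nonneg by simp
      show "u (t, x) - ?\<Psi> (t, x) \<le> u (t0, x0) - ?\<Psi> (t0, x0)"
        using le[OF t, of x] n eq z by simp
      assume "u (t, x) - ?\<Psi> (t, x) = u (t0, x0) - ?\<Psi> (t0, x0)"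
      then have "c * strictifier t0 x0 (t, x) = 0" using le[OF t, of x] n eq z by simp
      then show "t = t0" "\<exists>k::int. x = x0 + 2 * pi * of_int k"
        using c by (auto simp: strictifier_eq_0_iff)
    qed
    ultimately show ?thesis using u t0 by (simp add: viscosity_subsolution_def)
  qed
  then show ?thesis
    using pde_operator_strictified[OF C11 t0 pos]
    by (intro tendsto_upperbound[OF pde_value_tendsto[OF pos, where S = "{0<..}"]])
       (auto intro!: eventually_at_rightI[of 0 1])
qed

lemma supersolution_test:
  assumes v: "viscosity_supersolution v" and C11: "C11_with_gradient \<Phi> \<Phi>t \<Phi>x"
    and per: "\<And>t x. \<Phi> (t, x + 2 * pi) = \<Phi> (t, x) + a"
    and t0: "t0 > 0" and pos: "\<Phi>x (t0, x0) > 0"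
    and le: "\<And>t x. t \<ge> 0 \<Longrightarrow> v (t, x) \<ge> \<Phi> (t, x)" and eq: "v (t0, x0) = \<Phi> (t0, x0)"
  shows "\<Phi>t (t0, x0) + 1 / pi *
     (arctan (half_laplacian (\<lambda>x. \<Phi> (t0, x)) x0 / \<Phi>x (t0, x0)) + pi / 2) \<ge> 0"
proof -
  \<comment> \<open>A minimum becomes strict when the test function is lowered, hence the negative
    \<open>c\<close> and a limit from the left.\<close>
  have "pde_operator (\<lambda>p. \<Phi> p + c * strictifier t0 x0 p) t0 x0 \<ge> 0" if c: "c < 0" for c
  proof -
    let ?\<Psi> = "\<lambda>p. \<Phi> p + c * strictifier t0 x0 p"
    note A = C11_add[OF C11 strictifier_C11[of t0 x0], of c]
    have "test_function ?\<Psi>"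
      by (rule C11_test_function[OF A, of a])
        (simp add: per strictifier_periodic)
    moreover have "dx ?\<Psi> (t0, x0) \<noteq> 0" using pos by (simp add: C11_dx_eq[OF A])
    moreover have "strict_min_at (\<lambda>p. v p - ?\<Psi> p) t0 x0"
      unfolding strict_min_at_def
    proof (intro allI impI conjI)
      fix t x :: real assume t: "t \<ge> 0"
      have z: "strictifier t0 x0 (t0, x0) = 0" by (simp add: strictifier_def)
      have n: "c * strictifier t0 x0 (t, x) \<le> 0"
        using c strictifier_nonneg by (simp add: mult_nonpos_nonneg)
      show "v (t, x) - ?\<Psi> (t, x) \<ge> v (t0, x0) - ?\<Psi> (t0, x0)"
        using le[OF t, of x] n eq z by simp
      assume "v (t, x) - ?\<Psi> (t, x) = v (t0, x0) - ?\<Psi> (t0, x0)"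
      then have "c * strictifier t0 x0 (t, x) = 0" using le[OF t, of x] n eq z by simp
      then show "t = t0" "\<exists>k::int. x = x0 + 2 * pi * of_int k"
        using c by (auto simp: strictifier_eq_0_iff)
    qed
    ultimately show ?thesis using v t0 by (simp add: viscosity_supersolution_def)
  qed
  then show ?thesis
    using pde_operator_strictified[OF C11 t0 pos]
    by (intro tendsto_lowerbound[OF pde_value_tendsto[OF pos, where S = "{..<0}"]])
       (auto simp: intro!: eventually_at_leftI[of "-1" 0])
qed

section \<open>Semicontinuity and doubling of variables\<close>

text \<open>The filter \<open>at x within S\<close> excludes \<open>x\<close>, but at
  \<open>y = x\<close> the bound is automatic.\<close>

lemma usc_on_iff:
  "usc_on S F \<longleftrightarrow> (\<forall>x\<in>S. \<forall>e>0. \<exists>d>0. \<forall>y\<in>S. dist y x < d \<longrightarrow> F y < F x + e)"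
proof -
  have "Limsup (at x within S) (\<lambda>y. ereal (F y)) \<le> ereal (F x) \<longleftrightarrow>
     (\<forall>e>0. \<exists>d>0. \<forall>y\<in>S. dist y x < d \<longrightarrow> F y < F x + e)" for x
  proof
    assume L: "Limsup (at x within S) (\<lambda>y. ereal (F y)) \<le> ereal (F x)"
    show "\<forall>e>0. \<exists>d>0. \<forall>y\<in>S. dist y x < d \<longrightarrow> F y < F x + e"
    proof (intro allI impI)
      fix e :: real assume e: "e > 0"
      then have "eventually (\<lambda>y. ereal (F y) < ereal (F x + e)) (at x within S)"
        using L[unfolded Limsup_le_iff, rule_format, of "ereal (F x + e)"] by simp
      then obtain d where d: "d > 0" "\<And>y. y \<in> S \<Longrightarrow> y \<noteq> x \<Longrightarrow> dist y x < d \<Longrightarrow> F y < F x + e"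
        unfolding eventually_at by auto
      have "F y < F x + e" if "y \<in> S" "dist y x < d" for y
        using d(2)[of y] that e by (cases "y = x") auto
      then show "\<exists>d>0. \<forall>y\<in>S. dist y x < d \<longrightarrow> F y < F x + e" using d(1) by blast
    qed
  next
    assume A: "\<forall>e>0. \<exists>d>0. \<forall>y\<in>S. dist y x < d \<longrightarrow> F y < F x + e"
    show "Limsup (at x within S) (\<lambda>y. ereal (F y)) \<le> ereal (F x)"
    proof (rule ereal_le_epsilon2)
      fix e :: real assume "e > 0"
      then obtain d where d: "d > 0" "\<forall>y\<in>S. dist y x < d \<longrightarrow> F y < F x + e" using A by blast
      have "eventually (\<lambda>y. ereal (F y) \<le> ereal (F x) + ereal e) (at x within S)"
        unfolding eventually_at using d by (auto intro!: exI[of _ d] less_imp_le)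
      then show "Limsup (at x within S) (\<lambda>y. ereal (F y)) \<le> ereal (F x) + ereal e"
        by (rule Limsup_bounded)
    qed
  qed
  then show ?thesis unfolding usc_on_def by simp
qed

lemma lsc_on_iff_usc_on_uminus: "lsc_on S F \<longleftrightarrow> usc_on S (\<lambda>x. - F x)"
  unfolding lsc_on_def usc_on_def uminus_ereal.simps[symmetric] ereal_Limsup_uminus
  by (simp only: ereal_minus_le_minus)

lemma usc_on_subset: "usc_on S F \<Longrightarrow> T \<subseteq> S \<Longrightarrow> usc_on T F"
  unfolding usc_on_iff by (meson subsetD)

lemma usc_on_add:
  assumes "usc_on S F" "usc_on S G"
  shows "usc_on S (\<lambda>x. F x + G x)"
  unfolding usc_on_iff
proof (intro ballI allI impI)
  fix x and e :: real assume x: "x \<in> S" and e: "e > 0"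
  obtain d where d: "d > 0" "\<forall>y\<in>S. dist y x < d \<longrightarrow> F y < F x + e / 2"
    using assms(1) x half_gt_zero[OF e] unfolding usc_on_iff by metis
  obtain d' where d': "d' > 0" "\<forall>y\<in>S. dist y x < d' \<longrightarrow> G y < G x + e / 2"
    using assms(2) x half_gt_zero[OF e] unfolding usc_on_iff by metis
  have "\<forall>y\<in>S. dist y x < min d d' \<longrightarrow> F y + G y < F x + G x + e" using d(2) d'(2) by fastforce
  then show "\<exists>d>0. \<forall>y\<in>S. dist y x < d \<longrightarrow> F y + G y < F x + G x + e"
    using d(1) d'(1) by (meson min_less_iff_conj)
qed

lemma continuous_on_imp_usc_on:
  fixes F :: "'a::metric_space \<Rightarrow> real"
  assumes "continuous_on S F"
  shows "usc_on S F"
  unfolding usc_on_iff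
proof (intro ballI allI impI)
  fix x and e :: real assume "x \<in> S" "e > 0"
  then obtain d where "d > 0" "\<forall>y\<in>S. dist y x < d \<longrightarrow> dist (F y) (F x) < e"
    using assms unfolding continuous_on_iff by metis
  then show "\<exists>d>0. \<forall>y\<in>S. dist y x < d \<longrightarrow> F y < F x + e"
    by (intro exI[of _ d]) (auto simp: dist_real_def abs_less_iff)
qed

lemma usc_on_compose:
  assumes F: "usc_on T F" and g: "continuous_on S g" "g ` S \<subseteq> T"
  shows "usc_on S (\<lambda>x. F (g x))"
  unfolding usc_on_iff
proof (intro ballI allI impI)
  fix x and e :: real assume x: "x \<in> S" and e: "e > 0"
  then obtain d where d: "d > 0" "\<forall>y\<in>T. dist y (g x) < d \<longrightarrow> F y < F (g x) + e"
    using F g(2) unfolding usc_on_iff by blast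
  then obtain d' where "d' > 0" "\<forall>y\<in>S. dist y x < d' \<longrightarrow> dist (g y) (g x) < d"
    using g(1) x unfolding continuous_on_iff by metis
  then show "\<exists>d>0. \<forall>y\<in>S. dist y x < d \<longrightarrow> F (g y) < F (g x) + e"
    using d(2) g(2) by (intro exI[of _ d']) auto
qed

text \<open>If every \<open>x\<close> were beaten by some \<open>g x\<close>, semicontinuity would
  let \<open>g x\<close> beat a whole ball around \<open>x\<close>. Finitely many such balls cover
  \<open>S\<close>; the best of their finitely many beaters lies in one of the balls and would be
  beaten by another of them.\<close>

lemma usc_on_attains_max:
  assumes "compact S" "S \<noteq> {}" "usc_on S f"
  obtains x where "x \<in> S" "\<And>y. y \<in> S \<Longrightarrow> f y \<le> f x"
proof (rule ccontr)
  assume "\<not> thesis"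
  then have "\<forall>x\<in>S. \<exists>y\<in>S. f x < f y" using that by (meson not_le)
  then obtain g where g: "\<And>x. x \<in> S \<Longrightarrow> g x \<in> S" "\<And>x. x \<in> S \<Longrightarrow> f x < f (g x)" by metis
  have "\<forall>x\<in>S. \<exists>d>0. \<forall>y\<in>S. dist y x < d \<longrightarrow> f y < f (g x)"
  proof
    fix x assume "x \<in> S"
    then show "\<exists>d>0. \<forall>y\<in>S. dist y x < d \<longrightarrow> f y < f (g x)"
      using g(2)[of x] assms(3)[unfolded usc_on_iff, rule_format, of x "f (g x) - f x"] by simp
  qed
  then obtain d where d: "\<And>x. x \<in> S \<Longrightarrow> d x > 0"
      "\<And>x y. x \<in> S \<Longrightarrow> y \<in> S \<Longrightarrow> dist y x < d x \<Longrightarrow> f y < f (g x)" by metis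
  obtain C where C: "C \<subseteq> S" "finite C" "S \<subseteq> (\<Union>c\<in>C. ball c (d c))"
    by (rule compactE_image[OF assms(1), of S "\<lambda>c. ball c (d c)"]) (use d(1) in auto)
  have "C \<noteq> {}" using C assms(2) by auto
  define m where "m = Max ((\<lambda>c. f (g c)) ` C)"
  have "m \<in> (\<lambda>c. f (g c)) ` C" unfolding m_def using C \<open>C \<noteq> {}\<close> by (intro Max_in) auto
  then obtain c where c: "c \<in> C" "m = f (g c)" by auto
  obtain c' where c': "c' \<in> C" "g c \<in> ball c' (d c')" using C(1,3) c(1) g(1) by blast
  have "f (g c) < f (g c')" using c' C(1) c(1) g(1) by (intro d(2)) (auto simp: dist_commute)
  moreover have "f (g c') \<le> m" unfolding m_def using C(2) c'(1) by (intro Max_ge) auto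
  ultimately show False using c(2) by simp
qed

section \<open>Penalties in time\<close>

lemma has_real_derivative_max_square:
  "((\<lambda>t::real. (max 0 (t - c))\<^sup>2) has_real_derivative 2 * max 0 (t - c)) (at t)"
proof -
  \<comment> \<open>A quadratic bound on the remainder handles the kink at \<open>c\<close> and all
    other points alike.\<close>
  have "\<bar>(max 0 (s - c))\<^sup>2 - (max 0 (t - c))\<^sup>2 - 2 * max 0 (t - c) * (s - t)\<bar> \<le> (s - t)\<^sup>2" for s
  proof -
    consider "s \<ge> c" "t \<ge> c" | "s \<ge> c" "t < c" | "s < c" "t \<ge> c" | "s < c" "t < c" by linarith
    then show ?thesis
    proof cases
      case 1
      have "(s - c)\<^sup>2 - (t - c)\<^sup>2 - 2 * (t - c) * (s - t) = (s - t)\<^sup>2"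
        by (simp add: power2_eq_square algebra_simps)
      with 1 show ?thesis by simp
    next
      case 2
      then have "(s - c)\<^sup>2 \<le> (s - t)\<^sup>2" by (intro power_mono) auto
      with 2 show ?thesis by simp
    next
      case 3
      have "(t - c) * (t - c) - 2 * (t - c) * (s - c) \<ge> 0"
        using 3 mult_nonneg_nonpos[of "t - c" "s - c"] zero_le_square[of "t - c"] by linarith
      moreover have "(s - c)\<^sup>2 \<ge> 0" by simp
      moreover have "- (t - c)\<^sup>2 - 2 * (t - c) * (s - t) = (t - c) * (t - c) - 2 * (t - c) * (s - c)"
        "(s - t)\<^sup>2 = (s - c)\<^sup>2 + ((t - c) * (t - c) - 2 * (t - c) * (s - c))"
        by (simp_all add: power2_eq_square algebra_simps)
      ultimately show ?thesis using 3 by simp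
    qed simp
  qed
  then have b: "norm ((max 0 (s - c))\<^sup>2 - (max 0 (t - c))\<^sup>2 - 2 * max 0 (t - c) * (s - t)) / norm (s - t) \<le> norm (s - t)"
    if "s \<noteq> t" for s using that by (simp add: divide_le_eq power2_eq_square abs_mult[symmetric])
  show ?thesis unfolding has_field_derivative_def
  proof (rule has_derivativeI_sandwich[of 1])
    show "((\<lambda>s. norm (s - t)) \<longlongrightarrow> 0) (at t)" by (auto intro!: tendsto_eq_intros)
  qed (use b bounded_linear_mult_right in auto)
qed

text \<open>\<open>Q\<close> is the sum of \<open>c n * (max 0 (t - n))\<^sup>2\<close>, locally
  finite because the term \<open>n\<close> starts at time \<open>n\<close>. The squares keep it C^1,
  the vanishing of \<open>c n\<close> for \<open>n < N\<close> keeps it zero up to time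
  \<open>N\<close>, and the free coefficients cope with any growth of \<open>b\<close>.\<close>

lemma C1_dominating_function:
  fixes b :: "nat \<Rightarrow> real" and N :: nat
  obtains Q Q' :: "real \<Rightarrow> real"
  where "\<And>t. (Q has_real_derivative Q' t) (at t)" "continuous_on UNIV Q'"
    "\<And>t. Q' t \<ge> 0" "\<And>t. Q t \<ge> 0" "\<And>t. t \<le> real N \<Longrightarrow> Q t = 0" "\<And>t. t \<ge> real N + 1 \<Longrightarrow> b (nat \<lfloor>t\<rfloor>) \<le> Q t"
proof -
  \<comment> \<open>The index is shifted by one: when the floor of \<open>t\<close> is
    \<open>n + 1\<close>, the term \<open>n\<close> already has \<open>t - n \<ge> 1\<close> and
    reaches its full coefficient.\<close>
  define c where "c n = (if n < N then 0 else \<bar>b (Suc n)\<bar>)" for n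
  define q where "q M t = (\<Sum>n<M. c n * (max 0 (t - real n))\<^sup>2)" for M t
  define q' where "q' M t = (\<Sum>n<M. c n * (2 * max 0 (t - real n)))" for M t
  define Q where "Q t = q (nat \<lceil>t\<rceil>) t" for t
  define Q' where "Q' t = q' (nat \<lceil>t\<rceil>) t" for t
  have ge: "real n \<ge> t" if "n \<notin> {..<nat \<lceil>t\<rceil>}" for n t
    using that real_nat_ceiling_ge[of t] by (auto intro: order_trans)
  have sub: "{..<nat \<lceil>t\<rceil>} \<subseteq> {..<M}" if "t \<le> real M" for M t
    using that by (auto simp: less_le_trans nat_le_iff ceiling_le_iff)
  \<comment> \<open>The number of terms in \<open>Q t\<close> depends on \<open>t\<close>, but
    further terms vanish. Near each point \<open>Q\<close> is thus one fixed finite sum, which can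
    be differentiated termwise.\<close>
  have Q: "Q t = q M t" if "t \<le> real M" for M t
    unfolding Q_def q_def by (rule sum.mono_neutral_left[OF _ sub[OF that]]) (auto dest!: ge)
  have Q': "Q' t = q' M t" if "t \<le> real M" for M t
    unfolding Q'_def q'_def by (rule sum.mono_neutral_left[OF _ sub[OF that]]) (auto dest!: ge)
  have large: "\<exists>M. t < real M" for t by (rule reals_Archimedean2)
  have "(Q has_real_derivative Q' t) (at t)" for t
  proof -
    obtain M where M: "t < real M" using large by blast
    have "(q M has_real_derivative q' M t) (at t)"
      unfolding q_def[abs_def] q'_def by (intro DERIV_sum DERIV_cmult has_real_derivative_max_square)
    then have "(Q has_real_derivative q' M t) (at t)"
      by (rule has_field_derivative_transform_within_open[of _ _ _ "{..<real M}"]) (use M in \<open>auto intro: Q[symmetric] less_imp_le\<close>)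
    then show ?thesis using Q'[of t M] M by simp
  qed
  moreover have "continuous_on UNIV Q'"
  proof (rule continuous_at_imp_continuous_on, intro ballI)
    fix t :: real
    obtain M where M: "t < real M" using large by blast
    have "continuous_on {..<real M} (q' M)" unfolding q'_def[abs_def] by (intro continuous_intros)
    then have "continuous_on {..<real M} Q'" by (subst continuous_on_cong[OF refl, of _ _ "q' M"]) (use Q' in auto)
    then show "isCont Q' t" using M by (simp add: continuous_on_eq_continuous_at)
  qed
  moreover have "Q' t \<ge> 0" "Q t \<ge> 0" for t
    unfolding Q'_def q'_def Q_def q_def by (auto intro!: sum_nonneg simp: c_def)
  moreover have "Q t = 0" if "t \<le> real N" for t
    unfolding Q[OF that] q_def by (intro sum.neutral) (auto simp: c_def)
  moreover have "b (nat \<lfloor>t\<rfloor>) \<le> Q t" if t: "t \<ge> real N + 1" for t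
  proof -
    define n where "n = nat \<lfloor>t\<rfloor> - 1"
    have fl: "\<lfloor>t\<rfloor> \<ge> int N + 1" using t by (simp add: le_floor_iff)
    then have n: "Suc n = nat \<lfloor>t\<rfloor>" "n \<ge> N" by (auto simp: n_def nat_diff_distrib')
    have "real (nat \<lfloor>t\<rfloor>) \<le> t" using fl by (intro of_nat_floor) linarith
    then have "real (Suc n) \<le> t" by (simp only: n(1))
    then have tn: "t - real n \<ge> 1" by simp
    obtain M where M: "t < real M" using large by blast
    have "b (nat \<lfloor>t\<rfloor>) \<le> c n * 1" using n by (simp add: c_def)
    also have "\<dots> \<le> c n * (max 0 (t - real n))\<^sup>2"
      using tn by (intro mult_left_mono) (auto simp: c_def max_def)
    also have "\<dots> \<le> q M t" unfolding q_def
      by (rule member_le_sum) (use tn M in \<open>auto simp: c_def\<close>)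
    finally show ?thesis using Q[of t M] M by simp
  qed
  ultimately show thesis using that by blast
qed

section \<open>Doubling of variables for periodic functions\<close>

lemma add_period_int:
  fixes g :: "real \<Rightarrow> real"
  assumes "\<And>x. g (x + c) = g x + a"
  shows "g (x + c * of_int k) = g x + a * of_int k"
proof (induction k rule: int_induct[of _ 0])
  case (step1 i)
  then show ?case using assms[of "x + c * of_int i"] by (simp add: algebra_simps)
next
  case (step2 i)
  then show ?case using assms[of "x + c * of_int (i - 1)"] by (simp add: algebra_simps)
qed simp

lemma shift_into_period:
  obtains k :: int where "0 \<le> x + 2 * pi * of_int k" "x + 2 * pi * of_int k \<le> 2 * pi"
proof (rule that[of "- \<lfloor>x / (2 * pi)\<rfloor>"])
  have "of_int \<lfloor>x / (2 * pi)\<rfloor> * (2 * pi) \<le> x" "x < (of_int \<lfloor>x / (2 * pi)\<rfloor> + 1) * (2 * pi)"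
    by (simp_all add: floor_divide_lower floor_divide_upper)
  then show "0 \<le> x + 2 * pi * of_int (- \<lfloor>x / (2 * pi)\<rfloor>)" "x + 2 * pi * of_int (- \<lfloor>x / (2 * pi)\<rfloor>) \<le> 2 * pi"
    by (auto simp: algebra_simps)
qed

text \<open>For \<open>K \<ge> 1\<close> periodicity, the bounds and \<open>far\<close> confine the
  search for a maximum to a compact box. As \<open>K\<close> grows, the maximum stays at least the
  gap at \<open>(t0, x0)\<close>, which forces its two points together; if one of them were always
  at time 0, semicontinuity would yield a point at time 0 with \<open>W > Z\<close>.\<close>

lemma doubling_of_variables:
  fixes W Z :: "real \<times> real \<Rightarrow> real"
  assumes usc: "usc_on halfspace W" and lsc: "lsc_on halfspace Z"
    and perW: "\<And>t x. t \<ge> 0 \<Longrightarrow> W (t, x + 2 * pi) = W (t, x)"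
    and perZ: "\<And>t x. t \<ge> 0 \<Longrightarrow> Z (t, x + 2 * pi) = Z (t, x)"
    and W_le: "\<And>p. p \<in> halfspace \<Longrightarrow> W p \<le> C"
    and Z_ge: "\<And>p. p \<in> halfspace \<Longrightarrow> - C \<le> Z p"
    and far: "\<And>p q. p \<in> halfspace \<Longrightarrow> q \<in> halfspace \<Longrightarrow> fst p > T \<or> fst q > T \<Longrightarrow> W p \<le> Z q"
    and init: "\<And>x. W (0, x) \<le> Z (0, x)"
    and p0: "t0 \<ge> 0" "W (t0, x0) > Z (t0, x0)"
  obtains K p q where "K > 0" "p \<in> halfspace" "q \<in> halfspace" "fst p > 0" "fst q > 0"
    "\<And>p' q'. p' \<in> halfspace \<Longrightarrow> q' \<in> halfspace \<Longrightarrow>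
       W p' - Z q' - K * (norm (p' - q'))\<^sup>2 \<le> W p - Z q - K * (norm (p - q))\<^sup>2"
proof -
  define M where "M = W (t0, x0) - Z (t0, x0)"
  have M: "M > 0" using p0 by (simp add: M_def)
  have h[simp]: "(t, x) \<in> halfspace \<longleftrightarrow> t \<ge> 0" for t x by (simp add: halfspace_def)
  have C: "2 * C \<ge> M" using W_le[of "(t0, x0)"] Z_ge[of "(t0, x0)"] p0 by (simp add: M_def)
  have t0T: "t0 \<le> T" using far[of "(t0, x0)" "(t0, x0)"] p0 by force
  \<comment> \<open>A common shift brings the first point, but not the second, into one period.
    Where the penalised difference is positive, \<open>K \<ge> 1\<close> bounds the squared distance
    by \<open>2 * C\<close>, so the space coordinates differ by at most
    \<open>2 * C + 1\<close>.\<close>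
  define D where "D = ({0..T} \<times> {0..2 * pi}) \<times> ({0..T} \<times> {- (2 * C + 1)..2 * pi + (2 * C + 1)})"
  have cD: "compact D" unfolding D_def by (intro compact_Times compact_Icc)
  define f where "f = (\<lambda>K (p, q). W p - Z q - K * (norm (p - q))\<^sup>2)"
  have Dh: "p \<in> halfspace \<and> q \<in> halfspace" if "(p, q) \<in> D" for p q
    using that by (auto simp: D_def)
  have per: "W (t, x + 2 * pi * of_int k) = W (t, x)" "Z (t, x + 2 * pi * of_int k) = Z (t, x)"
    if "t \<ge> 0" for t x k
    using add_period_int[of "\<lambda>x. W (t, x)" "2 * pi" 0] add_period_int[of "\<lambda>x. Z (t, x)" "2 * pi" 0]
      perW[OF that] perZ[OF that] by auto
  have ex: "\<exists>p q. (p, q) \<in> D \<and> M \<le> f K (p, q) \<and>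
      (\<forall>p'\<in>halfspace. \<forall>q'\<in>halfspace. f K (p', q') \<le> f K (p, q))" if K: "K \<ge> 1" for K
  proof -
    obtain k :: int where k: "0 \<le> x0 + 2 * pi * of_int k" "x0 + 2 * pi * of_int k \<le> 2 * pi"
      by (rule shift_into_period)
    let ?p0 = "(t0, x0 + 2 * pi * of_int k)"
    have p0D: "(?p0, ?p0) \<in> D" using k p0 t0T C M by (simp add: D_def)
    have "usc_on D (\<lambda>z. W (fst z) + (- Z (snd z)) + (- (K * (norm (fst z - snd z))\<^sup>2)))"
    proof (rule usc_on_add[OF usc_on_add continuous_on_imp_usc_on])
      show "continuous_on D (\<lambda>z. - (K * (norm (fst z - snd z))\<^sup>2))" by (intro continuous_intros)
      show "usc_on D (\<lambda>z. W (fst z))"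
        by (rule usc_on_compose[OF usc]) (use Dh in \<open>auto intro!: continuous_intros\<close>)
      show "usc_on D (\<lambda>z. - Z (snd z))"
        by (rule usc_on_compose[OF lsc[unfolded lsc_on_iff_usc_on_uminus]])
           (use Dh in \<open>auto intro!: continuous_intros\<close>)
    qed
    then have "usc_on D (f K)" by (simp add: f_def case_prod_unfold)
    then obtain z where z: "z \<in> D" "\<And>y. y \<in> D \<Longrightarrow> f K y \<le> f K z"
      using usc_on_attains_max[OF cD, of "f K"] p0D by blast
    obtain p q where pq: "z = (p, q)" by (cases z)
    have fM: "M \<le> f K z" using z(2)[OF p0D] p0 by (simp add: f_def M_def per)
    have "f K (p', q') \<le> f K z" if hp: "p' \<in> halfspace" "q' \<in> halfspace" for p' q'
    proof (cases "f K (p', q') \<le> 0")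
      case False
      obtain t x s y where e: "p' = (t, x)" "q' = (s, y)" by (cases p', cases q')
      have ts0: "t \<ge> 0" "s \<ge> 0" using hp e by auto
      have Kn: "K * (norm (p' - q'))\<^sup>2 \<ge> (norm (p' - q'))\<^sup>2" using K by (simp add: mult_le_cancel_right1)
      have "W p' > Z q'" using False Kn zero_le_power2[of "norm (p' - q')"] unfolding f_def split by linarith
      then have ts: "t \<le> T" "s \<le> T" using far[OF hp] e by force+
      have "(norm (p' - q'))\<^sup>2 \<le> 2 * C"
        using False Kn W_le[OF hp(1)] Z_ge[OF hp(2)] unfolding f_def split by linarith
      moreover have "\<bar>x - y\<bar> \<le> norm (p' - q')"
        using norm_snd_le[of "x - y" "t - s"] by (simp add: e)
      then have "\<bar>x - y\<bar>\<^sup>2 \<le> (norm (p' - q'))\<^sup>2" by (intro power_mono) auto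
      ultimately have xy2: "\<bar>x - y\<bar>\<^sup>2 \<le> 2 * C" by linarith
      have xy: "\<bar>x - y\<bar> \<le> 2 * C + 1"
      proof (rule ccontr)
        assume a: "\<not> \<bar>x - y\<bar> \<le> 2 * C + 1"
        then have "\<bar>x - y\<bar> * 1 \<le> \<bar>x - y\<bar> * \<bar>x - y\<bar>" using C M by (intro mult_left_mono) auto
        then show False using a xy2 by (simp add: power2_eq_square)
      qed
      obtain k :: int where k: "0 \<le> x + 2 * pi * of_int k" "x + 2 * pi * of_int k \<le> 2 * pi"
        by (rule shift_into_period)
      have "((t, x + 2 * pi * of_int k), (s, y + 2 * pi * of_int k)) \<in> D"
        using k xy ts ts0 by (auto simp: D_def abs_le_iff)
      from z(2)[OF this] show ?thesis using ts0 by (simp add: f_def e per)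
    qed (use fM M in linarith)
    then show ?thesis using z(1) fM pq by blast
  qed
  have "\<forall>n. \<exists>z. z \<in> D \<and> M \<le> f (real n + 1) z \<and>
      (\<forall>p'\<in>halfspace. \<forall>q'\<in>halfspace. f (real n + 1) (p', q') \<le> f (real n + 1) z)"
    using ex by fastforce
  then obtain z where z: "\<And>n. z n \<in> D" "\<And>n. M \<le> f (real n + 1) (z n)"
      "\<And>n p' q'. p' \<in> halfspace \<Longrightarrow> q' \<in> halfspace \<Longrightarrow> f (real n + 1) (p', q') \<le> f (real n + 1) (z n)"
    by metis
  define P where "P n = fst (z n)" for n
  define R where "R n = snd (z n)" for n
  have zPR: "z n = (P n, R n)" for n by (simp add: P_def R_def)
  have PRh: "P n \<in> halfspace" "R n \<in> halfspace" for n using Dh z(1)[of n] zPR by auto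
  have MPR: "M \<le> W (P n) - Z (R n) - (real n + 1) * (norm (P n - R n))\<^sup>2" for n
    using z(2)[of n] by (simp add: f_def zPR)
  have "\<exists>n. fst (P n) > 0 \<and> fst (R n) > 0"
  proof (rule ccontr)
    assume "\<not> ?thesis"
    moreover have "fst (P n) \<ge> 0" "fst (R n) \<ge> 0" for n using PRh[of n] by (auto simp: halfspace_def)
    \<comment> \<open>Which of the two times vanishes may depend on \<open>n\<close>; the product is
      the form of this alternative that passes to the limit.\<close>
    ultimately have zero: "fst (P n) * fst (R n) = 0" for n by (metis less_eq_real_def mult_eq_0_iff)
    obtain l r where l: "l \<in> D" "strict_mono r" "(z \<circ> r) \<longlonglongrightarrow> l"
      using cD z(1) unfolding compact_def by metis
    obtain p q where pq: "l = (p, q)" by (cases l)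
    have limP: "(\<lambda>n. P (r n)) \<longlonglongrightarrow> p" and limR: "(\<lambda>n. R (r n)) \<longlonglongrightarrow> q"
      using tendsto_fst[OF l(3)] tendsto_snd[OF l(3)] by (simp_all add: P_def R_def pq o_def)
    have "(norm (P n - R n))\<^sup>2 \<le> 2 * C * (1 / real (Suc n))" for n
    proof -
      have "(real n + 1) * (norm (P n - R n))\<^sup>2 \<le> 2 * C"
        using MPR[of n] W_le[OF PRh(1)[of n]] Z_ge[OF PRh(2)[of n]] M by linarith
      then show ?thesis by (simp add: field_simps)
    qed
    moreover have "(\<lambda>n. 2 * C * (1 / real (Suc n))) \<longlonglongrightarrow> 0"
      by (intro tendsto_mult_right_zero LIMSEQ_Suc lim_1_over_n)
    ultimately have "(\<lambda>n. (norm (P n - R n))\<^sup>2) \<longlonglongrightarrow> 0"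
      by (intro Lim_null_comparison[of "\<lambda>n. (norm (P n - R n))\<^sup>2" "\<lambda>n. 2 * C * (1 / real (Suc n))"]) auto
    from LIMSEQ_subseq_LIMSEQ[OF this l(2)]
    have "(\<lambda>n. (norm (P (r n) - R (r n)))\<^sup>2) \<longlonglongrightarrow> 0" by (simp add: o_def)
    moreover have "(\<lambda>n. (norm (P (r n) - R (r n)))\<^sup>2) \<longlonglongrightarrow> (norm (p - q))\<^sup>2"
      by (intro tendsto_intros limP limR)
    ultimately have "(norm (p - q))\<^sup>2 = 0" using LIMSEQ_unique by blast
    then have pq': "q = p" by simp
    have "(\<lambda>n. fst (P (r n)) * fst (R (r n))) \<longlonglongrightarrow> fst p * fst q"
      by (intro tendsto_intros limP limR)
    then have "(\<lambda>n. 0) \<longlonglongrightarrow> fst p * fst q" by (simp only: zero)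
    then have "fst p * fst q = 0" by (rule LIMSEQ_unique[OF _ tendsto_const])
    then have p0: "fst p = 0" using pq' by simp
    have ph: "p \<in> halfspace" using Dh[of p q] l(1) pq by simp
    \<comment> \<open>The slack \<open>M / 2\<close> spent on each function uses up the gap
      \<open>M\<close> exactly; strictness of both estimates leaves \<open>W p > Z p\<close> at time
      0.\<close>
    obtain d where d: "d > 0" "\<forall>y\<in>halfspace. dist y p < d \<longrightarrow> W y < W p + M / 2"
      using usc ph half_gt_zero[OF M] unfolding usc_on_iff by metis
    obtain d' where d': "d' > 0" "\<forall>y\<in>halfspace. dist y p < d' \<longrightarrow> - Z y < - Z p + M / 2"
      using lsc[unfolded lsc_on_iff_usc_on_uminus] ph half_gt_zero[OF M] unfolding usc_on_iff by metis
    have "eventually (\<lambda>n. dist (P (r n)) p < d \<and> dist (R (r n)) p < d') sequentially"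
      using tendstoD[OF limP d(1)] tendstoD[OF limR d'(1)] pq' by (auto intro: eventually_conj)
    then obtain n where n: "dist (P (r n)) p < d" "dist (R (r n)) p < d'"
      by (auto simp: eventually_sequentially)
    have "(real (r n) + 1) * (norm (P (r n) - R (r n)))\<^sup>2 \<ge> 0" by simp
    moreover have "W (P (r n)) < W p + M / 2" "- Z (R (r n)) < - Z p + M / 2"
      using d(2) d'(2) n PRh by blast+
    ultimately have "M < W p - Z p + M" using MPR[of "r n"] by linarith
    then show False using init[of "snd p"] p0 by (cases p) simp
  qed
  then obtain n where "fst (P n) > 0" "fst (R n) > 0" by blast
  then show thesis
    using that[of "real n + 1" "P n" "R n"] PRh z(3)[of _ _ n] by (simp add: f_def zPR)
qed

section \<open>Comparison\<close>

lemma deriv_ge_of_slope: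
  assumes "(f has_real_derivative D) (at x)" and "\<And>h. h > 0 \<Longrightarrow> f (x + h) - f x \<ge> m * h"
  shows "D \<ge> m"
proof -
  have "((\<lambda>h. (f (x + h) - f x) / h) \<longlongrightarrow> D) (at_right 0)"
    using assms(1) unfolding DERIV_def by (rule tendsto_within_subset) simp
  moreover have "eventually (\<lambda>h. m \<le> (f (x + h) - f x) / h) (at_right 0)"
    by (intro eventually_at_rightI[of 0 1]) (use assms(2) in \<open>auto simp: le_divide_eq\<close>)
  ultimately show ?thesis by (rule tendsto_lowerbound) simp
qed

lemma linear_in_int_bounded_imp_0:
  fixes c :: real
  assumes "\<And>k::int. c * of_int k \<le> D"
  shows "c = 0"
proof (rule ccontr)
  assume "c \<noteq> 0"
  then obtain n :: nat where n: "D < real n * \<bar>c\<bar>" using reals_Archimedean3[of "\<bar>c\<bar>"] by auto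
  show False
    using assms[of "int n"] assms[of "- int n"] n by (cases "c \<ge> 0") (auto simp: algebra_simps)
qed

text \<open>Second differences annihilate affine functions. The left side has the shape of a time
  slice of the test functions used for comparison: translated, tilted by \<alpha>, with a constant
  \<open>c\<close> and the value \<open>e\<close> of the time penalty.\<close>

lemma half_laplacian_shift:
  "half_laplacian (\<lambda>x. f (x + b) + c + \<alpha> * x + e) \<theta> = half_laplacian f (\<theta> + b)"
proof -
  have "2 * (f (\<theta> + b) + c + \<alpha> * \<theta> + e) - (f (\<theta> - h + b) + c + \<alpha> * (\<theta> - h) + e)
      - (f (\<theta> + h + b) + c + \<alpha> * (\<theta> + h) + e) = 2 * f (\<theta> + b) - f (\<theta> + b - h) - f (\<theta> + b + h)" for h
    by (simp add: algebra_simps)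
  then show ?thesis unfolding half_laplacian_def by (simp only:)
qed

text \<open>The penalty \<open>l\<close> depends on time alone, so whatever its growth it leaves the
  space derivative Lipschitz.\<close>

lemma C11_shifted:
  fixes \<phi> :: "real \<times> real \<Rightarrow> real" and G :: "real \<times> real \<Rightarrow> real \<times> real"
  assumes \<phi>: "\<And>p. (\<phi> has_derivative (\<lambda>h. G p \<bullet> h)) (at p)" and G: "\<exists>L. L-lipschitz_on UNIV G"
    and l: "\<And>t. (l has_real_derivative l' t) (at t)" "continuous_on UNIV l'"
  shows "C11_with_gradient (\<lambda>z. \<phi> (z + d) + c + \<alpha> * snd z + l (fst z))
     (\<lambda>z. fst (G (z + d)) + l' (fst z)) (\<lambda>z. snd (G (z + d)) + \<alpha>)"
proof -
  obtain L where L: "L-lipschitz_on UNIV G" using G by blast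
  have "((\<lambda>z. \<phi> (z + d) + c + \<alpha> * snd z + l (fst z)) has_derivative
      (\<lambda>h. fst h * (fst (G (p + d)) + l' (fst p)) + snd h * (snd (G (p + d)) + \<alpha>))) (at p)" for p
  proof (rule has_derivative_eq_rhs)
    have "((\<lambda>z. \<phi> (z + d)) has_derivative (\<lambda>h. G (p + d) \<bullet> h)) (at p)"
      by (rule has_derivative_compose[of "\<lambda>z. z + d" "\<lambda>h. h" p UNIV \<phi>, OF _ \<phi>])
        (auto intro!: derivative_eq_intros)
    moreover have "((\<lambda>z. l (fst z)) has_derivative (\<lambda>h. l' (fst p) * fst h)) (at p)"
      by (rule has_derivative_compose[of fst fst p UNIV l, OF _ l(1)[unfolded has_field_derivative_def]])
        (auto intro!: derivative_eq_intros)
    ultimately show "((\<lambda>z. \<phi> (z + d) + c + \<alpha> * snd z + l (fst z)) has_derivative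
        (\<lambda>h. G (p + d) \<bullet> h + 0 + \<alpha> * snd h + l' (fst p) * fst h)) (at p)"
      by (intro has_derivative_add has_derivative_const has_derivative_mult_right has_derivative_snd
          has_derivative_ident)
  qed (auto simp: inner_prod_def algebra_simps)
  moreover have "continuous_on UNIV (\<lambda>z. fst (G (z + d)) + l' (fst z))"
  proof (intro continuous_intros)
    show "continuous_on UNIV (\<lambda>z. G (z + d))"
      by (rule continuous_on_compose2[OF lipschitz_on_continuous_on[OF L]]) (auto intro!: continuous_intros)
    show "continuous_on UNIV (\<lambda>z::real \<times> real. l' (fst z))"
      by (rule continuous_on_compose2[OF l(2)]) (auto intro!: continuous_intros)
  qed
  moreover have "L-lipschitz_on UNIV (\<lambda>z. snd (G (z + d)) + \<alpha>)"
  proof (rule lipschitz_onI)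
    fix z w :: "real \<times> real"
    have "dist (snd (G (z + d)) + \<alpha>) (snd (G (w + d)) + \<alpha>) = dist (snd (G (z + d))) (snd (G (w + d)))"
      by (simp add: dist_real_def)
    also have "\<dots> \<le> dist (G (z + d)) (G (w + d))" by (rule dist_snd_le)
    also have "\<dots> \<le> L * dist (z + d) (w + d)" by (rule lipschitz_onD[OF L]) auto
    finally show "dist (snd (G (z + d)) + \<alpha>) (snd (G (w + d)) + \<alpha>) \<le> L * dist z w" by simp
  qed (rule lipschitz_on_nonneg[OF L])
  ultimately show ?thesis unfolding C11_with_gradient_def by blast
qed

lemma usc_periodic_bounded_above:
  assumes usc: "usc_on halfspace U" and per: "\<And>t x. t \<ge> 0 \<Longrightarrow> U (t, x + 2 * pi) = U (t, x)"
  obtains B where "\<And>t x. 0 \<le> t \<Longrightarrow> t \<le> T \<Longrightarrow> U (t, x) \<le> B"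
proof (cases "T \<ge> 0")
  case True
  let ?D = "{0..T} \<times> {0..2 * pi}"
  have "usc_on ?D U" by (rule usc_on_subset[OF usc]) (auto simp: halfspace_def)
  then obtain z where z: "\<And>y. y \<in> ?D \<Longrightarrow> U y \<le> U z"

  proof (rule usc_on_attains_max[rotated 2])
    show "compact ?D" by (intro compact_Times compact_Icc)
    show "?D \<noteq> {}" using True by auto
  qed (rule that)
  have "U (t, x) \<le> U z" if t: "0 \<le> t" "t \<le> T" for t x
  proof -
    obtain k :: int where "0 \<le> x + 2 * pi * of_int k" "x + 2 * pi * of_int k \<le> 2 * pi"
      by (rule shift_into_period)
    then have "U (t, x + 2 * pi * of_int k) \<le> U z" using t z by simp
    then show ?thesis
      using add_period_int[of "\<lambda>x. U (t, x)" "2 * pi" 0 x k] per t by simp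
  qed
  then show thesis by (rule that)
qed (use that in force)

text \<open>Both \<open>u\<close> and \<open>v\<close> are tested with translates of one and the same function \<open>\<phi>\<close>, which
  separates the sup-convolution of \<open>u\<close> from the inf-convolution of \<open>v\<close> and touches both at
  \<open>r0\<close>. Hence the nonlocal terms agree and cancel, and the strictly increasing penalty
  \<open>l\<close> gives the contradiction.\<close>

lemma comparison:
  assumes u: "viscosity_subsolution u" and v: "viscosity_supersolution v"
    and m: "m > 0" and slope: "\<And>t x h. t \<ge> 0 \<Longrightarrow> h \<ge> 0 \<Longrightarrow> u (t, x + h) - u (t, x) \<ge> m * h"
    and init: "\<And>x. u (0, x - s) \<le> v (0, x)" and "t \<ge> 0"
  shows "u (t, x - s) \<le> v (t, x)"
proof (rule ccontr)
  assume contr: "\<not> ?thesis"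

  \<comment> \<open>Reduction to periodic functions\<close>
  obtain a where a: "\<And>t x. t \<ge> 0 \<Longrightarrow> u (t, x + 2 * pi) = u (t, x) + a"
    using u by (auto simp: viscosity_subsolution_def quasi_periodic_def)
  obtain a' where a': "\<And>t x. t \<ge> 0 \<Longrightarrow> v (t, x + 2 * pi) = v (t, x) + a'"
    using v by (auto simp: viscosity_supersolution_def quasi_periodic_def)
  \<comment> \<open>The initial comparison at \<open>s + 2 * pi * k\<close> for integers
    \<open>k\<close> of both signs forces the increments per period to agree.\<close>
  have "(a - a') * of_int k \<le> v (0, s) - u (0, 0)" for k :: int
    using init[of "s + 2 * pi * of_int k"]
      add_period_int[of "\<lambda>x. u (0, x)" "2 * pi" a 0 k, OF a]
      add_period_int[of "\<lambda>x. v (0, x)" "2 * pi" a' s k, OF a']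
    by (simp add: algebra_simps)
  then have aa: "a' = a" using linear_in_int_bounded_imp_0 by fastforce
  have h[simp]: "(t, x) \<in> halfspace \<longleftrightarrow> t \<ge> 0" for t x by (simp add: halfspace_def)
  have fst_h: "p \<in> halfspace \<longleftrightarrow> fst p \<ge> 0" for p by (cases p) simp
  \<comment> \<open>Subtracting the common mean slope makes both functions periodic; the translation
    by \<open>s\<close> is absorbed into \<open>U\<close>.\<close>
  define \<alpha> where "\<alpha> = a / (2 * pi)"
  have \<alpha>: "\<alpha> * (2 * pi) = a" by (simp add: \<alpha>_def)
  define U where "U p = u (fst p, snd p - s) - \<alpha> * snd p" for p
  define V where "V p = v p - \<alpha> * snd p" for p
  have perU: "U (t, x + 2 * pi) = U (t, x)" if "t \<ge> 0" for t x
    using a[OF that, of "x - s"] \<alpha> by (simp add: U_def algebra_simps)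
  have perV: "V (t, x + 2 * pi) = V (t, x)" if "t \<ge> 0" for t x
    using a'[OF that, of x] \<alpha> aa by (simp add: V_def algebra_simps)
  have uscU: "usc_on halfspace U"
  proof -
    have "usc_on halfspace (\<lambda>p. u (fst p, snd p - s))"
    proof (rule usc_on_compose[of halfspace u])
      show "usc_on halfspace u" using u by (simp add: viscosity_subsolution_def)
      show "continuous_on halfspace (\<lambda>p::real \<times> real. (fst p, snd p - s))" by (intro continuous_intros)
      show "(\<lambda>p. (fst p, snd p - s)) ` halfspace \<subseteq> halfspace" by (auto simp: fst_h)
    qed
    moreover have "continuous_on halfspace (\<lambda>p. - (\<alpha> * snd p))" by (intro continuous_intros)
    ultimately show ?thesis
      using usc_on_add[OF _ continuous_on_imp_usc_on] by (fastforce simp: U_def[abs_def])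
  qed
  have uscV: "usc_on halfspace (\<lambda>p. - V p)"
  proof -
    have "usc_on halfspace (\<lambda>p. - v p)"
      using v by (simp add: viscosity_supersolution_def lsc_on_iff_usc_on_uminus)
    moreover have "continuous_on halfspace (\<lambda>p. \<alpha> * snd p)" by (intro continuous_intros)
    ultimately show ?thesis
      using usc_on_add[OF _ continuous_on_imp_usc_on] by (fastforce simp: V_def[abs_def])
  qed

  \<comment> \<open>Penalisation in time\<close>
  have "\<exists>B\<ge>0. \<forall>t x. 0 \<le> t \<longrightarrow> t \<le> real n + 1 \<longrightarrow> U (t, x) \<le> B \<and> - B \<le> V (t, x)" for n :: nat
  proof -
    obtain B where B: "\<And>t x. 0 \<le> t \<Longrightarrow> t \<le> real n + 1 \<Longrightarrow> U (t, x) \<le> B"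
      using usc_periodic_bounded_above[OF uscU perU, of "real n + 1"] by blast
    obtain B' where B': "\<And>t x. 0 \<le> t \<Longrightarrow> t \<le> real n + 1 \<Longrightarrow> - V (t, x) \<le> B'"
      using usc_periodic_bounded_above[OF uscV, of "real n + 1"] perV by auto
    have "U (t, x) \<le> \<bar>B\<bar> + \<bar>B'\<bar> \<and> - (\<bar>B\<bar> + \<bar>B'\<bar>) \<le> V (t, x)" if "0 \<le> t" "t \<le> real n + 1" for t x
      using B[OF that, of x] B'[OF that, of x] by linarith
    then show ?thesis by (intro exI[of _ "\<bar>B\<bar> + \<bar>B'\<bar>"]) auto
  qed
  then obtain b where b0: "\<And>n. b n \<ge> 0" and bU: "\<And>n t x. 0 \<le> t \<Longrightarrow> t \<le> real n + 1 \<Longrightarrow> U (t, x) \<le> b n"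
      and bV: "\<And>n t x. 0 \<le> t \<Longrightarrow> t \<le> real n + 1 \<Longrightarrow> - b n \<le> V (t, x)" by metis
  define N where "N = nat \<lceil>t\<rceil>"
  have tN: "t \<le> real N" unfolding N_def by (rule real_nat_ceiling_ge)
  define C where "C = b N"
  \<comment> \<open>The added \<open>C\<close> pushes \<open>W\<close> below \<open>- C\<close> and
    \<open>Z\<close> above \<open>C\<close> from time \<open>N + 1\<close> on, while
    \<open>W \<le> C\<close> and \<open>- C \<le> Z\<close> hold throughout; a pair with a later
    time thus cannot have \<open>W p > Z q\<close>. Up to time \<open>N\<close>, in particular at
    \<open>t\<close>, \<open>Q\<close> costs nothing.\<close>
  obtain Q Q' where Q: "\<And>t. (Q has_real_derivative Q' t) (at t)" "continuous_on UNIV Q'"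
      "\<And>t. Q' t \<ge> 0" "\<And>t. Q t \<ge> 0" "\<And>t. t \<le> real N \<Longrightarrow> Q t = 0"
      "\<And>t. t \<ge> real N + 1 \<Longrightarrow> b (nat \<lfloor>t\<rfloor>) + C \<le> Q t"
    using C1_dominating_function[of N "\<lambda>n. b n + C"] by metis
  \<comment> \<open>The penalty is charged to both functions, so at time \<open>t\<close> it costs
    \<open>2 * \<eta> * t\<close>, the fraction \<open>t / (t + 1)\<close> of the gap. The summand 2
    covers \<open>t = 0\<close>.\<close>
  define \<eta> where "\<eta> = (u (t, x - s) - v (t, x)) / (2 * t + 2)"
  have \<eta>: "\<eta> > 0" "2 * (\<eta> * t) < u (t, x - s) - v (t, x)"
  proof -
    have d: "u (t, x - s) - v (t, x) > 0" "2 * t + 2 > 0" using contr \<open>t \<ge> 0\<close> by auto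
    then show "\<eta> > 0" by (simp add: \<eta>_def)
    moreover have "\<eta> * (2 * t + 2) = u (t, x - s) - v (t, x)" using d by (simp add: \<eta>_def)
    ultimately show "2 * (\<eta> * t) < u (t, x - s) - v (t, x)" by (simp add: algebra_simps)
  qed
  define l where "l t = \<eta> * t + Q t" for t
  define l' where "l' t = \<eta> + Q' t" for t
  have l: "(l has_real_derivative l' t) (at t)" for t
    unfolding l_def[abs_def] l'_def by (auto intro!: derivative_eq_intros Q(1))
  have cl': "continuous_on UNIV l'" unfolding l'_def[abs_def] by (intro continuous_intros Q(2))
  have l'_pos: "l' t > 0" for t using \<eta>(1) Q(3)[of t] by (simp add: l'_def)
  have lQ: "l t \<ge> Q t" "l t \<ge> 0" if "t \<ge> 0" for t using \<eta>(1) that Q(4)[of t] by (simp_all add: l_def)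
  have cont_l: "continuous_on S (\<lambda>p::real \<times> real. l (fst p))" for S
    by (rule continuous_on_compose2[of UNIV l])
      (auto intro!: continuous_intros continuous_at_imp_continuous_on DERIV_isCont[OF l])
  define W where "W p = U p - l (fst p)" for p
  define Z where "Z p = V p + l (fst p)" for p
  have uscW: "usc_on halfspace W"
    using usc_on_add[OF uscU continuous_on_imp_usc_on[OF continuous_on_minus[OF cont_l]]]
    by (simp add: W_def[abs_def])
  have lscZ: "lsc_on halfspace Z"
    using usc_on_add[OF uscV continuous_on_imp_usc_on[OF continuous_on_minus[OF cont_l]]]
    by (simp add: Z_def[abs_def] lsc_on_iff_usc_on_uminus)
  have WZ: "W p \<le> C" "- C \<le> Z p" if p: "p \<in> halfspace" "fst p \<le> real N + 1" for p
    using bU[of "fst p" N "snd p"] bV[of "fst p" N "snd p"] lQ(2)[of "fst p"] p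
    by (auto simp: W_def Z_def C_def fst_h)
  have WZ_far: "W p \<le> - C" "C \<le> Z p" if p: "p \<in> halfspace" "fst p \<ge> real N + 1" for p
  proof -
    have "fst p \<le> real (nat \<lfloor>fst p\<rfloor>) + 1" using p(2) by linarith
    then show "W p \<le> - C" "C \<le> Z p"
      using bU[of "fst p" "nat \<lfloor>fst p\<rfloor>" "snd p"] bV[of "fst p" "nat \<lfloor>fst p\<rfloor>" "snd p"]
        lQ(1)[of "fst p"] Q(6)[OF p(2)] p(1)
      by (auto simp: W_def Z_def fst_h)
  qed
  have C0: "C \<ge> 0" using b0 by (simp add: C_def)
  have WC: "W p \<le> C" and ZC: "- C \<le> Z p" if "p \<in> halfspace" for p
    using WZ[OF that] WZ_far[OF that] C0 by (cases "fst p \<le> real N + 1"; simp)+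
  have W0: "W (t, x) > Z (t, x)"
    using \<eta>(2) Q(5)[OF tN] by (simp add: W_def Z_def U_def V_def l_def)
  have init0: "W (0, x) \<le> Z (0, x)" for x
    using init[of x] lQ(2)[of 0] by (simp add: W_def Z_def U_def V_def)
  have far: "W p \<le> Z q" if "p \<in> halfspace" "q \<in> halfspace" "fst p > real N + 1 \<or> fst q > real N + 1" for p q
    using that WZ_far(1)[of p] WZ_far(2)[of q] WC[of p] ZC[of q] by linarith
  have perW: "W (t, x + 2 * pi) = W (t, x)" and perZ: "Z (t, x + 2 * pi) = Z (t, x)" if "t \<ge> 0" for t x
    using perU perV that by (simp_all add: W_def Z_def)

  \<comment> \<open>Doubling and separation\<close>
  obtain K p q where K: "K > 0" and ph: "p \<in> halfspace" and qh: "q \<in> halfspace"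
    and tp: "fst p > 0" and tq: "fst q > 0" and max: "\<And>p' q'. p' \<in> halfspace \<Longrightarrow> q' \<in> halfspace \<Longrightarrow>
       W p' - Z q' - K * (norm (p' - q'))\<^sup>2 \<le> W p - Z q - K * (norm (p - q))\<^sup>2"
  proof (rule doubling_of_variables[OF uscW lscZ perW perZ WC ZC far init0 \<open>t \<ge> 0\<close> W0])
  qed (assumption+, rule that)
  define M where "M = W p - Z q - K * (norm (p - q))\<^sup>2"
  \<comment> \<open>A detour through \<open>r\<close> doubles the constant, since a squared sum is
    at most twice the sum of squares; equality holds when \<open>r\<close> is the midpoint of
    \<open>q1\<close> and \<open>q2\<close>.\<close>
  have sep: "W q1 - 2 * K * (norm (r - q1))\<^sup>2 \<le> (M + Z q2) + 2 * K * (norm (r - q2))\<^sup>2"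
    if "q1 \<in> halfspace" "q2 \<in> halfspace" for r q1 q2
  proof -
    have "(norm (q1 - q2))\<^sup>2 \<le> 2 * (norm (r - q1))\<^sup>2 + 2 * (norm (r - q2))\<^sup>2"
    proof -
      have "norm (q1 - q2) \<le> norm (r - q1) + norm (r - q2)"
        using norm_triangle_ineq4[of "r - q2" "r - q1"] by simp
      then have "(norm (q1 - q2))\<^sup>2 \<le> (norm (r - q1) + norm (r - q2))\<^sup>2" by (intro power_mono) auto
      also have "\<dots> \<le> 2 * (norm (r - q1))\<^sup>2 + 2 * (norm (r - q2))\<^sup>2"
        using zero_le_power2[of "norm (r - q1) - norm (r - q2)"] by (simp add: power2_eq_square algebra_simps)
      finally show ?thesis .
    qed
    then have "K * (norm (q1 - q2))\<^sup>2 \<le> K * (2 * (norm (r - q1))\<^sup>2 + 2 * (norm (r - q2))\<^sup>2)"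
      using K by (intro mult_left_mono) auto
    then show ?thesis using max[OF that] by (simp add: M_def algebra_simps)
  qed
  have hne: "halfspace \<noteq> {}" using ph by blast
  obtain \<phi> G where
    \<phi>W: "\<And>r q1. q1 \<in> halfspace \<Longrightarrow> W q1 - 2 * K * (norm (r - q1))\<^sup>2 \<le> \<phi> r" and
    \<phi>Z: "\<And>r q2. q2 \<in> halfspace \<Longrightarrow> \<phi> r \<le> (M + Z q2) + 2 * K * (norm (r - q2))\<^sup>2" and
    G: "\<And>p. (\<phi> has_derivative (\<lambda>h. G p \<bullet> h)) (at p)" "\<exists>L. L-lipschitz_on UNIV G" and
    inv: "\<And>d p. \<forall>q. q + d \<in> halfspace \<longleftrightarrow> q \<in> halfspace \<Longrightarrow>
       \<forall>q\<in>halfspace. M + Z (q + d) = M + Z q \<Longrightarrow> \<phi> (p + d) = \<phi> p"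
  proof (rule C11_separation[of "2 * K" halfspace W "\<lambda>q. M + Z q", OF _ hne sep])
    show "2 * K \<ge> 0" using K by simp
  qed (assumption+, rule that)
  have per\<phi>: "\<phi> (r + (0, 2 * pi)) = \<phi> r" for r
    by (rule inv) (auto simp: fst_h perZ split_paired_all)
  \<comment> \<open>At the midpoint the lower bound through \<open>W p\<close> and the upper bound
    through \<open>Z q\<close> coincide and pin down \<open>\<phi> r0\<close>.\<close>
  define r0 where "r0 = (1 / 2) *\<^sub>R (p + q)"
  define c1 where "c1 = 2 * K * (norm (r0 - p))\<^sup>2"
  have rp: "r0 - p = (1 / 2) *\<^sub>R (q - p)" and rq: "r0 - q = (1 / 2) *\<^sub>R (p - q)"
    by (simp_all add: r0_def algebra_simps prod_eq_iff)
  have c1: "c1 = K * (norm (p - q))\<^sup>2 / 2" "c1 = 2 * K * (norm (r0 - q))\<^sup>2"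
    by (simp_all add: c1_def rp rq power_divide norm_minus_commute)
  have touch: "\<phi> r0 = W p - c1" "\<phi> r0 = M + Z q + c1"
  proof -
    have "W p - c1 \<le> \<phi> r0" using \<phi>W[OF ph, of r0] by (simp add: c1_def)
    moreover have "\<phi> r0 \<le> M + Z q + c1" using \<phi>Z[OF qh, of r0] c1(2) by linarith
    moreover have "M + Z q = W p - 2 * c1" by (simp add: M_def c1(1))
    ultimately show "\<phi> r0 = W p - c1" "\<phi> r0 = M + Z q + c1" by linarith+
  qed

  \<comment> \<open>Test function for the subsolution\<close>
  define d1 where "d1 = r0 - p + (0, s)"
  \<comment> \<open>This undoes the passage from \<open>u\<close> to \<open>W\<close>:
    \<open>d1\<close> carries \<open>(fst p, snd p - s)\<close> to \<open>r0\<close>, and the last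
    two terms restore the mean slope and the penalty. The constant \<open>\<alpha> * s\<close>
    appears because \<open>U\<close> measures the tilt at the translated point.\<close>
  define \<Phi>1 where "\<Phi>1 = (\<lambda>z. \<phi> (z + d1) + (c1 + \<alpha> * s) + \<alpha> * snd z + l (fst z))"
  have C1: "C11_with_gradient \<Phi>1 (\<lambda>z. fst (G (z + d1)) + l' (fst z)) (\<lambda>z. snd (G (z + d1)) + \<alpha>)"
    unfolding \<Phi>1_def by (rule C11_shifted[OF G l cl'])
  have per1: "\<Phi>1 (t, x + 2 * pi) = \<Phi>1 (t, x) + a" for t x
    using per\<phi>[of "(t, x) + d1"] \<alpha> by (simp add: \<Phi>1_def algebra_simps)
  define x1 where "x1 = snd p - s"
  have zr: "(fst p, x1) + d1 = r0" by (simp add: x1_def d1_def prod_eq_iff)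
  have le1: "u (t, x) \<le> \<Phi>1 (t, x)" if "t \<ge> 0" for t x
  proof -
    have "(t, x) + d1 - (t, x + s) = r0 - p" by (simp add: d1_def prod_eq_iff)
    then have "W (t, x + s) \<le> \<phi> ((t, x) + d1) + c1"
      using \<phi>W[of "(t, x + s)" "(t, x) + d1"] that by (simp add: c1_def)
    then show ?thesis by (simp add: \<Phi>1_def W_def U_def algebra_simps)
  qed
  have eq1: "u (fst p, x1) = \<Phi>1 (fst p, x1)"
    unfolding \<Phi>1_def zr using touch(1) by (simp add: W_def U_def x1_def algebra_simps)
  \<comment> \<open>Lying above \<open>u\<close> and touching it, \<Phi>1 has forward increments at
    least those of \<open>u\<close>. The positive number obtained is also the space derivative of
    \<Phi>2 at the contact point with \<open>v\<close>.\<close>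
  have "m \<le> snd (G ((fst p, x1) + d1)) + \<alpha>"
  proof (rule deriv_ge_of_slope)
    show "((\<lambda>y. \<Phi>1 (fst p, y)) has_real_derivative snd (G ((fst p, x1) + d1)) + \<alpha>) (at x1)"
      using C11_deriv_x[OF C1] .
    show "m * h \<le> \<Phi>1 (fst p, x1 + h) - \<Phi>1 (fst p, x1)" if "h > 0" for h
      using slope[of "fst p" h x1] le1[of "fst p" "x1 + h"] eq1 tp that by simp
  qed
  then have pos: "snd (G r0) + \<alpha> > 0" using m unfolding zr by simp
  have HL1: "half_laplacian (\<lambda>x. \<Phi>1 (fst p, x)) x1 = half_laplacian (\<lambda>x. \<phi> (fst r0, x)) (snd r0)"
  proof -
    have "(fst p, x) + d1 = (fst r0, x + snd d1)" for x by (simp add: d1_def prod_eq_iff)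
    moreover have "x1 + snd d1 = snd r0" using zr by (simp add: prod_eq_iff)
    ultimately show ?thesis
      using half_laplacian_shift[of "\<lambda>x. \<phi> (fst r0, x)"] by (simp add: \<Phi>1_def)
  qed
  have sub: "fst (G r0) + l' (fst p) + 1 / pi * (arctan (half_laplacian (\<lambda>x. \<phi> (fst r0, x)) (snd r0)
      / (snd (G r0) + \<alpha>)) + pi / 2) \<le> 0"
    using subsolution_test[OF u C1 per1 tp _ le1 eq1] pos unfolding zr HL1 by simp

  \<comment> \<open>Test function for the supersolution\<close>
  define d2 where "d2 = r0 - q"
  \<comment> \<open>The penalty enters with the opposite sign, so the time derivatives of \<Phi>1
    and \<Phi>2 at their contact points differ by \<open>l' (fst p) + l' (fst q)\<close>, which is
    positive even when the contact times are different.\<close>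
  define \<Phi>2 where "\<Phi>2 = (\<lambda>z. \<phi> (z + d2) + (- c1 - M) + \<alpha> * snd z + - l (fst z))"
  have C2: "C11_with_gradient \<Phi>2 (\<lambda>z. fst (G (z + d2)) + - l' (fst z)) (\<lambda>z. snd (G (z + d2)) + \<alpha>)"
    unfolding \<Phi>2_def
    by (rule C11_shifted[OF G DERIV_minus[OF l] continuous_on_minus[OF cl']])
  have per2: "\<Phi>2 (t, x + 2 * pi) = \<Phi>2 (t, x) + a" for t x
    using per\<phi>[of "(t, x) + d2"] \<alpha> by (simp add: \<Phi>2_def algebra_simps)
  have zq: "(fst q, snd q) + d2 = r0" by (simp add: d2_def prod_eq_iff)
  have le2: "v (t, x) \<ge> \<Phi>2 (t, x)" if "t \<ge> 0" for t x
    using \<phi>Z[of "(t, x)" "(t, x) + d2"] that c1(2)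
    by (simp add: \<Phi>2_def Z_def V_def d2_def)
  have eq2: "v (fst q, snd q) = \<Phi>2 (fst q, snd q)"
    unfolding \<Phi>2_def zq using touch(2) by (simp add: Z_def V_def)
  have HL2: "half_laplacian (\<lambda>x. \<Phi>2 (fst q, x)) (snd q) = half_laplacian (\<lambda>x. \<phi> (fst r0, x)) (snd r0)"
  proof -
    have "(fst q, x) + d2 = (fst r0, x + snd d2)" for x by (simp add: d2_def prod_eq_iff)
    moreover have "snd q + snd d2 = snd r0" using zq by (simp add: prod_eq_iff)
    ultimately show ?thesis
      using half_laplacian_shift[of "\<lambda>x. \<phi> (fst r0, x)" "snd d2" _ _ "- l (fst q)"] by (simp add: \<Phi>2_def)
  qed
  have super: "fst (G r0) - l' (fst q) + 1 / pi * (arctan (half_laplacian (\<lambda>x. \<phi> (fst r0, x)) (snd r0)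
      / (snd (G r0) + \<alpha>)) + pi / 2) \<ge> 0"
    using supersolution_test[OF v C2 per2 tq _ le2 eq2] pos unfolding zq HL2 by simp
  show False using sub super l'_pos[of "fst p"] l'_pos[of "fst q"] by linarith
qed

section \<open>Uniqueness\<close>

lemma locally_bounded_on_eventually:
  assumes "locally_bounded_on S F" "x \<in> S"
  obtains B where "eventually (\<lambda>y. \<bar>F y\<bar> \<le> B) (inf (nhds x) (principal S))"
proof -
  obtain r where r: "r > 0" "bounded (F ` (S \<inter> ball x r))"
    using assms unfolding locally_bounded_on_def by blast
  then obtain B where "\<And>y. y \<in> S \<Longrightarrow> y \<in> ball x r \<Longrightarrow> \<bar>F y\<bar> \<le> B"
    unfolding bounded_iff by (metis IntI imageI real_norm_def)
  then have "eventually (\<lambda>y. \<bar>F y\<bar> \<le> B) (inf (nhds x) (principal S))"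
    unfolding eventually_inf_principal eventually_nhds using r(1)
    by (intro exI[of _ "ball x r"]) auto
  then show thesis by (rule that)
qed

text \<open>Local boundedness makes the limits in the definitions of the envelopes finite.\<close>

lemma
  fixes F :: "'a::metric_space \<Rightarrow> real"
  assumes x: "x \<in> S" and bdd: "eventually (\<lambda>y. \<bar>F y\<bar> \<le> B) (inf (nhds x) (principal S))"
  shows ereal_lower_env: "ereal (lower_env S F x) = Liminf (inf (nhds x) (principal S)) (\<lambda>y. ereal (F y))"
    and ereal_upper_env: "ereal (upper_env S F x) = Limsup (inf (nhds x) (principal S)) (\<lambda>y. ereal (F y))"
proof -
  let ?\<F> = "inf (nhds x) (principal S)"
  have ne: "?\<F> \<noteq> bot"
    using x by (auto simp: trivial_limit_def eventually_inf_principal dest: eventually_nhds_x_imp_x)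
  have "ereal (- B) \<le> Liminf ?\<F> (\<lambda>y. ereal (F y))"
    by (rule Liminf_bounded) (use bdd in \<open>auto elim: eventually_mono\<close>)
  moreover have "Limsup ?\<F> (\<lambda>y. ereal (F y)) \<le> ereal B"
    by (rule Limsup_bounded) (use bdd in \<open>auto elim: eventually_mono\<close>)
  moreover note Liminf_le_Limsup[OF ne, of "\<lambda>y. ereal (F y)"]
  ultimately have "\<bar>Liminf ?\<F> (\<lambda>y. ereal (F y))\<bar> \<noteq> \<infinity>" "\<bar>Limsup ?\<F> (\<lambda>y. ereal (F y))\<bar> \<noteq> \<infinity>"
    by auto
  then show "ereal (lower_env S F x) = Liminf ?\<F> (\<lambda>y. ereal (F y))"
    "ereal (upper_env S F x) = Limsup ?\<F> (\<lambda>y. ereal (F y))"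
    by (simp_all add: lower_env_def upper_env_def ereal_real')
qed

text \<open>The filter in the envelope keeps the point \<open>x\<close> itself, so each of its
  events holds at \<open>x\<close>.\<close>

lemma lower_env_le:
  assumes "locally_bounded_on S F" "x \<in> S"
  shows "lower_env S F x \<le> F x"
proof -
  obtain B where B: "eventually (\<lambda>y. \<bar>F y\<bar> \<le> B) (inf (nhds x) (principal S))"
    using locally_bounded_on_eventually[OF assms] .
  have "Liminf (inf (nhds x) (principal S)) (\<lambda>y. ereal (F y)) \<le> ereal (F x)"
    unfolding Liminf_def
    using assms(2) by (intro SUP_least INF_lower) (auto simp: eventually_inf_principal dest: eventually_nhds_x_imp_x)
  then show ?thesis using ereal_lower_env[OF assms(2) B] by (metis ereal_less_eq(3))
qed

lemma le_upper_env:
  assumes "locally_bounded_on S F" "x \<in> S"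
  shows "F x \<le> upper_env S F x"
proof -
  obtain B where B: "eventually (\<lambda>y. \<bar>F y\<bar> \<le> B) (inf (nhds x) (principal S))"
    using locally_bounded_on_eventually[OF assms] .
  have "ereal (F x) \<le> Limsup (inf (nhds x) (principal S)) (\<lambda>y. ereal (F y))"
    unfolding Limsup_def
    using assms(2) by (intro INF_greatest SUP_upper) (auto simp: eventually_inf_principal dest: eventually_nhds_x_imp_x)
  then show ?thesis using ereal_upper_env[OF assms(2) B] by (metis ereal_less_eq(3))
qed

text \<open>A neighbourhood of \<open>x\<close> that stays on one side of \<open>y\<close> has
  values on one side of \<open>f y\<close>. A jump at \<open>x\<close> is thus absorbed by an
  arbitrarily small move.\<close>

lemma mono_env_bounds:
  fixes f :: "real \<Rightarrow> real"
  assumes f: "mono f"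
  shows "x < y \<Longrightarrow> upper_env UNIV f x \<le> f y" and "y < x \<Longrightarrow> f y \<le> lower_env UNIV f x"
proof -
  have B: "eventually (\<lambda>z. \<bar>f z\<bar> \<le> \<bar>f (x - 1)\<bar> + \<bar>f (x + 1)\<bar>) (inf (nhds x) (principal UNIV))"
    unfolding eventually_inf_principal eventually_nhds
  proof (intro exI[of _ "{x - 1<..<x + 1}"] conjI ballI impI)
    fix z assume "z \<in> {x - 1<..<x + 1}"
    then have "f (x - 1) \<le> f z" "f z \<le> f (x + 1)" by (auto intro: monoD[OF f])
    then show "\<bar>f z\<bar> \<le> \<bar>f (x - 1)\<bar> + \<bar>f (x + 1)\<bar>" by linarith
  qed auto
  show "upper_env UNIV f x \<le> f y" if "x < y"
  proof -
    have "eventually (\<lambda>z. z < y) (nhds x)"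
      using eventually_nhds_in_open[of "{..<y}" x] that by simp
    then have "Limsup (inf (nhds x) (principal UNIV)) (\<lambda>z. ereal (f z)) \<le> ereal (f y)"
      by (intro Limsup_bounded) (auto simp: eventually_inf_principal elim!: eventually_mono intro: monoD[OF f])
    then show ?thesis using ereal_upper_env[OF UNIV_I B] by (metis ereal_less_eq(3))
  qed
  show "f y \<le> lower_env UNIV f x" if "y < x"
  proof -
    have "eventually (\<lambda>z. y < z) (nhds x)"
      using eventually_nhds_in_open[of "{y<..}" x] that by simp
    then have "ereal (f y) \<le> Liminf (inf (nhds x) (principal UNIV)) (\<lambda>z. ereal (f z))"
      by (intro Liminf_bounded) (auto simp: eventually_inf_principal elim!: eventually_mono intro: monoD[OF f])
    then show ?thesis using ereal_lower_env[OF UNIV_I B] by (metis ereal_less_eq(3))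
  qed
qed

text \<open>The initial datum may jump, so \<open>F \<le> G\<^sub>*\<close> can fail at \<open>t = 0\<close>. It holds for the translate
  \<open>F (t, x - s)\<close>, \<open>s > 0\<close>, since the datum is increasing; upper semicontinuity of \<open>G\<close> lets \<open>s\<close> tend to \<open>0\<close>.\<close>

lemma viscosity_solution_le:
  assumes F0: "mono F0"
    and F: "viscosity_solution F" "has_initial_condition F F0"
    and m: "m > 0" and slope: "\<And>t x h. t \<ge> 0 \<Longrightarrow> h \<ge> 0 \<Longrightarrow> F (t, x + h) - F (t, x) \<ge> m * h"
    and G: "viscosity_solution G" "has_initial_condition G F0"
    and t: "t \<ge> 0"
  shows "F (t, x) \<le> G (t, x)"
proof -
  have h: "(r, y) \<in> halfspace \<longleftrightarrow> r \<ge> 0" for r y by (simp add: halfspace_def)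
  have lb: "locally_bounded_on halfspace F" "locally_bounded_on halfspace G"
    using F(1) G(1) by (simp_all add: viscosity_solution_def)
  have shifted: "F (t, y - s) \<le> G (t, y)" if s: "s > 0" for s y
  proof -
    have "F (0, z - s) \<le> lower_env halfspace G (0, z)" for z
    proof -
      have "F (0, z - s) \<le> upper_env halfspace F (0, z - s)" by (rule le_upper_env[OF lb(1)]) (simp add: h)
      also have "\<dots> \<le> upper_env UNIV F0 (z - s)" using F(2) by (simp add: has_initial_condition_def)
      \<comment> \<open>The intermediate point lies strictly between the two points where envelopes
        are taken, so jumps of the datum at either of them are harmless.\<close>
      also have "\<dots> \<le> F0 (z - s / 2)" by (rule mono_env_bounds(1)[OF F0]) (use s in simp)
      also have "\<dots> \<le> lower_env UNIV F0 z" by (rule mono_env_bounds(2)[OF F0]) (use s in simp)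
      also have "\<dots> \<le> lower_env halfspace G (0, z)" using G(2) by (simp add: has_initial_condition_def)
      finally show ?thesis .
    qed
    then have "F (t, y - s) \<le> lower_env halfspace G (t, y)"
      using F(1) G(1) by (intro comparison[OF _ _ m slope _ t]) (simp_all add: viscosity_solution_def)
    also have "\<dots> \<le> G (t, y)" by (rule lower_env_le[OF lb(2)]) (simp add: h t)
    finally show ?thesis .
  qed
  show ?thesis
  proof (rule field_le_epsilon)
    fix e :: real assume "e > 0"
    moreover have "usc_on halfspace G"
      using G(1) by (simp add: viscosity_solution_def viscosity_subsolution_def)
    ultimately obtain d where d: "d > 0" "\<forall>q\<in>halfspace. dist q (t, x) < d \<longrightarrow> G q < G (t, x) + e"
      using t h unfolding usc_on_iff by meson
    \<comment> \<open>Shifting by \<open>d / 2\<close> at the point \<open>x + d / 2\<close> keeps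
      the argument of \<open>F\<close> at \<open>x\<close>; only \<open>G\<close> moves, and it is
      upper semicontinuous.\<close>
    have "G (t, x + d / 2) < G (t, x) + e" using d t by (auto simp: h dist_Pair_Pair dist_real_def)
    then show "F (t, x) \<le> G (t, x) + e" using shifted[of "d / 2" "x + d / 2"] d(1) by simp
  qed
qed

theorem theorem1p2:
  fixes m m' :: real and \<mu> :: "complex measure" and F G :: "real \<times> real \<Rightarrow> real"
  assumes "m > 0"
    and "prob_measure_torus \<mu>"
    and "\<And>\<theta> h. h \<ge> 0 \<Longrightarrow> torus_cdf \<mu> (\<theta> + h) - torus_cdf \<mu> \<theta> \<ge> m * h"
    and "0 < m'" and "m' \<le> m"
    and "viscosity_solution F" and "has_initial_condition F (torus_cdf \<mu>)"
    and "\<And>t \<theta> h. t \<ge> 0 \<Longrightarrow> h \<ge> 0 \<Longrightarrow> F (t, \<theta> + h) - F (t, \<theta>) \<ge> m' * h"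
    and "viscosity_solution G" and "has_initial_condition G (torus_cdf \<mu>)"
    and "\<And>t \<theta> h. t \<ge> 0 \<Longrightarrow> h \<ge> 0 \<Longrightarrow> G (t, \<theta> + h) - G (t, \<theta>) \<ge> m' * h"
  shows "\<forall>t\<ge>0. \<forall>\<theta>. F (t, \<theta>) = G (t, \<theta>)"
proof -
  have mono: "mono (torus_cdf \<mu>)"
  proof (rule monoI)
    fix x y :: real assume "x \<le> y"
    then have "0 \<le> m * (y - x)" using assms(1) by simp
    also have "\<dots> \<le> torus_cdf \<mu> y - torus_cdf \<mu> x" using assms(3)[of "y - x" x] \<open>x \<le> y\<close> by simp
    finally show "torus_cdf \<mu> x \<le> torus_cdf \<mu> y" by simp
  qed
  show ?thesis
  proof (intro allI impI antisym)
    fix t \<theta> :: real assume t: "t \<ge> 0"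
    show "F (t, \<theta>) \<le> G (t, \<theta>)"
      by (rule viscosity_solution_le[OF mono assms(6,7,4) _ assms(9,10) t]) (rule assms(8))
    show "G (t, \<theta>) \<le> F (t, \<theta>)"
      by (rule viscosity_solution_le[OF mono assms(9,10,4) _ assms(6,7) t]) (rule assms(11))
  qed
qed

end
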